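(* Let $R$ be a ring, and let $I$ be a two-sided ideal of $R$ that is the trace ideal of a projective right $R$-module. Let $P'$ be a projective right module over $R/I$. Then there exists a projective right $R$-module $P$ such that $I\subseteq \mathrm{Tr}(P)$, $P/PI\cong P'$ and $\mathrm{Tr}(P)/I=\mathrm{Tr}_{R/I}(P')$.
   Context: Rings are associative with $1$. Modules are not assumed to be finitely or countably generated. The trace ideal of a right module $P$ over a ring $S$ is the two-sided ideal $\mathrm{Tr}(P)=\mathrm{Tr}_S(P)=\sum_{f\in \mathrm{Hom}_S(P,S)}f(P)$ of $S$. *)

theory Defs
  imports "HOL-Algebra.QuotRing" "HOL-Algebra.Generated_Groups"
begin

section \<open>Right modules\<close>

text \<open>
  The library locale \<open>module\<close> is restricted to commutative rings.  As in the library's record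
  for modules, the multiplicative fields of the ring record carry no information.
\<close>

record ('a, 'b) rmodule = "'b ring" +
  ract :: "'b \<Rightarrow> 'a \<Rightarrow> 'b" (infixl \<open>\<bullet>\<index>\<close> 70)

locale right_module = R?: ring R + M?: abelian_group M for R (structure) and M (structure) +
  assumes ract_closed [simp, intro]:
      "\<lbrakk>x \<in> carrier M; a \<in> carrier R\<rbrakk> \<Longrightarrow> x \<bullet>\<^bsub>M\<^esub> a \<in> carrier M"
    and ract_l_distr:
      "\<lbrakk>x \<in> carrier M; y \<in> carrier M; a \<in> carrier R\<rbrakk> \<Longrightarrow>
        (x \<oplus>\<^bsub>M\<^esub> y) \<bullet>\<^bsub>M\<^esub> a = x \<bullet>\<^bsub>M\<^esub> a \<oplus>\<^bsub>M\<^esub> y \<bullet>\<^bsub>M\<^esub> a"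
    and ract_r_distr:
      "\<lbrakk>x \<in> carrier M; a \<in> carrier R; b \<in> carrier R\<rbrakk> \<Longrightarrow>
        x \<bullet>\<^bsub>M\<^esub> (a \<oplus>\<^bsub>R\<^esub> b) = x \<bullet>\<^bsub>M\<^esub> a \<oplus>\<^bsub>M\<^esub> x \<bullet>\<^bsub>M\<^esub> b"
    and ract_assoc:
      "\<lbrakk>x \<in> carrier M; a \<in> carrier R; b \<in> carrier R\<rbrakk> \<Longrightarrow>
        x \<bullet>\<^bsub>M\<^esub> (a \<otimes>\<^bsub>R\<^esub> b) = (x \<bullet>\<^bsub>M\<^esub> a) \<bullet>\<^bsub>M\<^esub> b"
    and ract_one [simp]: "x \<in> carrier M \<Longrightarrow> x \<bullet>\<^bsub>M\<^esub> \<one>\<^bsub>R\<^esub> = x"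

definition rmod_hom ::
    "('r, 'x) ring_scheme \<Rightarrow> ('r, 'm) rmodule \<Rightarrow> ('r, 'n) rmodule \<Rightarrow> ('m \<Rightarrow> 'n) set" where
  "rmod_hom R M N = {f. f \<in> carrier M \<rightarrow> carrier N \<and>
     (\<forall>x\<in>carrier M. \<forall>y\<in>carrier M. f (x \<oplus>\<^bsub>M\<^esub> y) = f x \<oplus>\<^bsub>N\<^esub> f y) \<and>
     (\<forall>x\<in>carrier M. \<forall>a\<in>carrier R. f (x \<bullet>\<^bsub>M\<^esub> a) = f x \<bullet>\<^bsub>N\<^esub> a)}"

definition rmod_iso ::
    "('r, 'x) ring_scheme \<Rightarrow> ('r, 'm) rmodule \<Rightarrow> ('r, 'n) rmodule \<Rightarrow> bool" where
  "rmod_iso R M N \<longleftrightarrow> (\<exists>f\<in>rmod_hom R M N. bij_betw f (carrier M) (carrier N))"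

definition regular_rmod :: "('r, 'x) ring_scheme \<Rightarrow> ('r, 'r) rmodule" where
  "regular_rmod R = \<lparr>carrier = carrier R, mult = mult R, one = \<one>\<^bsub>R\<^esub>,
     zero = \<zero>\<^bsub>R\<^esub>, add = add R, ract = mult R\<rparr>"

definition rmod_trace :: "('r, 'x) ring_scheme \<Rightarrow> ('r, 'm) rmodule \<Rightarrow> 'r set" where
  "rmod_trace R P =
     generate (add_monoid R) (\<Union>f\<in>rmod_hom R P (regular_rmod R). f ` carrier P)"

text \<open>The submodule \<open>M I\<close> generated by the products \<open>x a\<close> (for a two-sided ideal \<open>I\<close>,
  the additive subgroup they generate is already a submodule).\<close>

definition rmod_mult_ideal ::
    "('r, 'm) rmodule \<Rightarrow> 'r set \<Rightarrow> 'm set" where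
  "rmod_mult_ideal M I = generate (add_monoid M) {x \<bullet>\<^bsub>M\<^esub> a | x a. x \<in> carrier M \<and> a \<in> I}"

text \<open>\<open>M / M I\<close> as a right module over \<open>R Quot I\<close>.  Cosets act as in \<^const>\<open>rcoset_mult\<close>:
  the union has \<open>(M I + x) (I + a) = M I + x a\<close> as its value.\<close>

definition quot_rmod :: "('r, 'm) rmodule \<Rightarrow> 'r set \<Rightarrow> ('r set, 'm set) rmodule" where
  "quot_rmod M I = (let N = rmod_mult_ideal M I in
     \<lparr>carrier = a_rcosets\<^bsub>M\<^esub> N, mult = undefined, one = undefined,
      zero = N, add = set_add M,
      ract = (\<lambda>X A. \<Union>x\<in>X. \<Union>a\<in>A. N +>\<^bsub>M\<^esub> (x \<bullet>\<^bsub>M\<^esub> a))\<rparr>)"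

section \<open>Projective modules\<close>

text \<open>
  Projectivity is the lifting property along surjections \<open>g\<close> from \<open>M\<close> onto \<open>N\<close>.  A definition
  cannot quantify over all types; the carrier types chosen for \<open>M\<close> and \<open>N\<close> accommodate the
  free module on the elements of \<open>P\<close> and \<open>P\<close> itself, and this is enough to obtain lifting for
  \<open>M\<close> and \<open>N\<close> over arbitrary types: see \<open>projective_rmod_lift\<close> below.
\<close>

definition projective_rmod :: "('r, 'x) ring_scheme \<Rightarrow> ('r, 'm) rmodule \<Rightarrow> bool" where
  "projective_rmod R P \<longleftrightarrow> right_module R P \<and>
     (\<forall>(M :: ('r, 'm \<Rightarrow> 'r) rmodule) (N :: ('r, 'm) rmodule) g f.
        right_module R M \<and> right_module R N \<and>
        g \<in> rmod_hom R M N \<and> g ` carrier M = carrier N \<and> f \<in> rmod_hom R P N \<longrightarrow>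
        (\<exists>h\<in>rmod_hom R P M. \<forall>x\<in>carrier P. g (h x) = f x))"

definition free_rmod :: "('r, 'x) ring_scheme \<Rightarrow> 'i set \<Rightarrow> ('r, 'i \<Rightarrow> 'r) rmodule" where
  "free_rmod R X =
     \<lparr>carrier = {\<phi>. (\<forall>i. \<phi> i \<in> carrier R) \<and> finite {i. \<phi> i \<noteq> \<zero>\<^bsub>R\<^esub>} \<and> {i. \<phi> i \<noteq> \<zero>\<^bsub>R\<^esub>} \<subseteq> X},
      mult = undefined, one = undefined,
      zero = (\<lambda>i. \<zero>\<^bsub>R\<^esub>), add = (\<lambda>\<phi> \<psi> i. \<phi> i \<oplus>\<^bsub>R\<^esub> \<psi> i), ract = (\<lambda>\<phi> a i. \<phi> i \<otimes>\<^bsub>R\<^esub> a)\<rparr>"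

lemma free_rmod_right_module:
  fixes R :: "('r, 'x) ring_scheme" (structure) and X :: "'i set"
  assumes "ring R"
  shows "right_module R (free_rmod R X)"
proof -
  interpret ring R by fact
  have fin: "finite {i. \<phi> i \<oplus> \<psi> i \<noteq> \<zero>}" "{i. \<phi> i \<oplus> \<psi> i \<noteq> \<zero>} \<subseteq> X"
    if "finite {i. \<phi> i \<noteq> \<zero>}" "{i. \<phi> i \<noteq> \<zero>} \<subseteq> X" "finite {i. \<psi> i \<noteq> \<zero>}" "{i. \<psi> i \<noteq> \<zero>} \<subseteq> X"
    for \<phi> \<psi> :: "'i \<Rightarrow> 'r"
  proof -
    have "{i. \<phi> i \<oplus> \<psi> i \<noteq> \<zero>} \<subseteq> {i. \<phi> i \<noteq> \<zero>} \<union> {i. \<psi> i \<noteq> \<zero>}" by auto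
    then show "finite {i. \<phi> i \<oplus> \<psi> i \<noteq> \<zero>}" "{i. \<phi> i \<oplus> \<psi> i \<noteq> \<zero>} \<subseteq> X"
      using that by (auto intro: finite_subset)
  qed
  have fina: "finite {i. \<phi> i \<otimes> a \<noteq> \<zero>}" "{i. \<phi> i \<otimes> a \<noteq> \<zero>} \<subseteq> X"
    if "finite {i. \<phi> i \<noteq> \<zero>}" "{i. \<phi> i \<noteq> \<zero>} \<subseteq> X" "a \<in> carrier R"
    for \<phi> :: "'i \<Rightarrow> 'r" and a
  proof -
    have "{i. \<phi> i \<otimes> a \<noteq> \<zero>} \<subseteq> {i. \<phi> i \<noteq> \<zero>}" using that by auto
    then show "finite {i. \<phi> i \<otimes> a \<noteq> \<zero>}" "{i. \<phi> i \<otimes> a \<noteq> \<zero>} \<subseteq> X"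
      using that by (auto intro: finite_subset)
  qed
  have "abelian_group (free_rmod R X)"
  proof (rule abelian_groupI)
    fix \<phi> assume \<phi>: "\<phi> \<in> carrier (free_rmod R X)"
    then have eq: "{i. \<ominus> \<phi> i \<noteq> \<zero>} = {i. \<phi> i \<noteq> \<zero>}"
      by (auto simp: free_rmod_def)
    show "\<exists>\<psi>\<in>carrier (free_rmod R X). \<psi> \<oplus>\<^bsub>free_rmod R X\<^esub> \<phi> = \<zero>\<^bsub>free_rmod R X\<^esub>"
      using \<phi> eq by (intro bexI[of _ "\<lambda>i. \<ominus> \<phi> i"]) (auto simp: free_rmod_def l_neg)
  qed (use fin in \<open>auto simp: free_rmod_def a_assoc a_comm a_lcomm fun_eq_iff\<close>)
  then show ?thesis
    by (intro right_module.intro right_module_axioms.intro assms)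
       (use fina in \<open>auto simp: free_rmod_def l_distr r_distr m_assoc fun_eq_iff\<close>)
qed

context right_module
begin

lemma ract_zero [simp]: "x \<in> carrier M \<Longrightarrow> x \<bullet>\<^bsub>M\<^esub> \<zero>\<^bsub>R\<^esub> = \<zero>\<^bsub>M\<^esub>"
  by (metis M.add.r_cancel_one' R.add.l_one R.add.one_closed ract_closed ract_r_distr)

lemma zero_ract [simp]: "a \<in> carrier R \<Longrightarrow> \<zero>\<^bsub>M\<^esub> \<bullet>\<^bsub>M\<^esub> a = \<zero>\<^bsub>M\<^esub>"
  by (metis M.add.r_cancel_one' M.add.l_one M.add.one_closed ract_closed ract_l_distr)

lemma finsum_ract:
  assumes "finite S" "f \<in> S \<rightarrow> carrier M" "a \<in> carrier R"
  shows "finsum M f S \<bullet>\<^bsub>M\<^esub> a = finsum M (\<lambda>i. f i \<bullet>\<^bsub>M\<^esub> a) S"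
  using assms(1,2)
proof (induction S rule: finite_induct)
  case (insert i S)
  then show ?case
    using assms(3) by (simp add: Pi_iff ract_l_distr)
qed (use assms(3) in simp)

end

definition free_eval ::
    "('r, 'x) ring_scheme \<Rightarrow> ('r, 'm) rmodule \<Rightarrow> ('i \<Rightarrow> 'm) \<Rightarrow> ('i \<Rightarrow> 'r) \<Rightarrow> 'm" where
  "free_eval R M m \<phi> = (\<Oplus>\<^bsub>M\<^esub>i\<in>{i. \<phi> i \<noteq> \<zero>\<^bsub>R\<^esub>}. m i \<bullet>\<^bsub>M\<^esub> \<phi> i)"

lemma free_eval_superset:
  assumes "right_module R M" "m \<in> X \<rightarrow> carrier M" "\<phi> \<in> carrier (free_rmod R X)"
    and "finite S" "{i. \<phi> i \<noteq> \<zero>\<^bsub>R\<^esub>} \<subseteq> S" "S \<subseteq> X"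
  shows "free_eval R M m \<phi> = (\<Oplus>\<^bsub>M\<^esub>i\<in>S. m i \<bullet>\<^bsub>M\<^esub> \<phi> i)"
proof -
  interpret right_module R M by fact
  show ?thesis
    unfolding free_eval_def
    by (rule M.add.finprod_mono_neutral_cong_left)
       (use assms in \<open>auto simp: free_rmod_def Pi_iff subset_iff\<close>)
qed

lemma free_eval_hom:
  assumes "right_module R M" "m \<in> X \<rightarrow> carrier M"
  shows "free_eval R M m \<in> rmod_hom R (free_rmod R X) M"
proof -
  interpret right_module R M by fact
  interpret F: right_module R "free_rmod R X"
    by (rule free_rmod_right_module) (rule R.ring_axioms)
  note sup = free_eval_superset[OF assms]
  have carr: "\<phi> i \<in> carrier R" "finite {i. \<phi> i \<noteq> \<zero>\<^bsub>R\<^esub>}" "{i. \<phi> i \<noteq> \<zero>\<^bsub>R\<^esub>} \<subseteq> X"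
    if "\<phi> \<in> carrier (free_rmod R X)" for \<phi> i
    using that by (auto simp: free_rmod_def)
  have m: "m i \<in> carrier M" if "i \<in> X" for i using assms(2) that by auto
  show ?thesis
    unfolding rmod_hom_def
  proof (intro CollectI conjI ballI)
    show "free_eval R M m \<in> carrier (free_rmod R X) \<rightarrow> carrier M"
      unfolding free_eval_def using carr m
      by (intro Pi_I M.finsum_closed) (auto simp: subset_iff)
  next
    fix \<phi> \<psi> assume \<phi>: "\<phi> \<in> carrier (free_rmod R X)" and \<psi>: "\<psi> \<in> carrier (free_rmod R X)"
    let ?S = "{i. \<phi> i \<noteq> \<zero>\<^bsub>R\<^esub>} \<union> {i. \<psi> i \<noteq> \<zero>\<^bsub>R\<^esub>}"
    let ?s = "\<phi> \<oplus>\<^bsub>free_rmod R X\<^esub> \<psi>"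
    have s: "?s i = \<phi> i \<oplus>\<^bsub>R\<^esub> \<psi> i" for i by (simp add: free_rmod_def)
    have S: "finite ?S" "?S \<subseteq> X" using carr \<phi> \<psi> by auto
    have sub: "{i. ?s i \<noteq> \<zero>\<^bsub>R\<^esub>} \<subseteq> ?S" by (auto simp: s)
    have "free_eval R M m ?s = (\<Oplus>\<^bsub>M\<^esub>i\<in>?S. m i \<bullet>\<^bsub>M\<^esub> ?s i)"
      by (rule sup) (use \<phi> \<psi> S sub in auto)
    also have "\<dots> = (\<Oplus>\<^bsub>M\<^esub>i\<in>?S. m i \<bullet>\<^bsub>M\<^esub> \<phi> i \<oplus>\<^bsub>M\<^esub> m i \<bullet>\<^bsub>M\<^esub> \<psi> i)"
      by (rule M.finsum_cong')
         (use S m carr(1)[OF \<phi>] carr(1)[OF \<psi>] in \<open>auto simp: s ract_r_distr subset_iff\<close>)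
    also have "\<dots> = (\<Oplus>\<^bsub>M\<^esub>i\<in>?S. m i \<bullet>\<^bsub>M\<^esub> \<phi> i) \<oplus>\<^bsub>M\<^esub> (\<Oplus>\<^bsub>M\<^esub>i\<in>?S. m i \<bullet>\<^bsub>M\<^esub> \<psi> i)"
      by (rule M.finsum_addf)
         (use S m carr(1)[OF \<phi>] carr(1)[OF \<psi>] in \<open>auto simp: subset_iff\<close>)
    also have "\<dots> = free_eval R M m \<phi> \<oplus>\<^bsub>M\<^esub> free_eval R M m \<psi>"
      using sup[OF \<phi> S(1)] sup[OF \<psi> S(1)] S by auto
    finally show "free_eval R M m ?s = free_eval R M m \<phi> \<oplus>\<^bsub>M\<^esub> free_eval R M m \<psi>" .
  next
    fix \<phi> a assume \<phi>: "\<phi> \<in> carrier (free_rmod R X)" and a: "a \<in> carrier R"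
    let ?S = "{i. \<phi> i \<noteq> \<zero>\<^bsub>R\<^esub>}"
    let ?s = "\<phi> \<bullet>\<^bsub>free_rmod R X\<^esub> a"
    have s: "?s i = \<phi> i \<otimes>\<^bsub>R\<^esub> a" for i by (simp add: free_rmod_def)
    have S: "finite ?S" "?S \<subseteq> X" using carr[OF \<phi>] by auto
    have sub: "{i. ?s i \<noteq> \<zero>\<^bsub>R\<^esub>} \<subseteq> ?S" using a by (auto simp: s)
    have "free_eval R M m ?s = (\<Oplus>\<^bsub>M\<^esub>i\<in>?S. m i \<bullet>\<^bsub>M\<^esub> ?s i)"
      by (rule sup) (use \<phi> a S sub in auto)
    also have "\<dots> = (\<Oplus>\<^bsub>M\<^esub>i\<in>?S. (m i \<bullet>\<^bsub>M\<^esub> \<phi> i) \<bullet>\<^bsub>M\<^esub> a)"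
      by (rule M.finsum_cong')
         (use S m carr(1)[OF \<phi>] a in \<open>auto simp: s ract_assoc subset_iff\<close>)
    also have "\<dots> = free_eval R M m \<phi> \<bullet>\<^bsub>M\<^esub> a"
      unfolding free_eval_def
      by (rule finsum_ract[symmetric])
         (use S m carr(1)[OF \<phi>] a in \<open>auto simp: subset_iff\<close>)
    finally show "free_eval R M m ?s = free_eval R M m \<phi> \<bullet>\<^bsub>M\<^esub> a" .
  qed
qed

lemma rmod_hom_zero:
  assumes "right_module R M" "right_module R N" "f \<in> rmod_hom R M N"
  shows "f \<zero>\<^bsub>M\<^esub> = \<zero>\<^bsub>N\<^esub>"
proof -
  interpret M: right_module R M by fact
  interpret N: right_module R N by fact
  have c: "f \<zero>\<^bsub>M\<^esub> \<in> carrier N"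
    using assms(3) by (auto simp: rmod_hom_def)
  have "f (\<zero>\<^bsub>M\<^esub> \<oplus>\<^bsub>M\<^esub> \<zero>\<^bsub>M\<^esub>) = f \<zero>\<^bsub>M\<^esub> \<oplus>\<^bsub>N\<^esub> f \<zero>\<^bsub>M\<^esub>"
    using assms(3) M.M.zero_closed unfolding rmod_hom_def by blast
  then have "f \<zero>\<^bsub>M\<^esub> \<oplus>\<^bsub>N\<^esub> f \<zero>\<^bsub>M\<^esub> = f \<zero>\<^bsub>M\<^esub>" by simp
  then show ?thesis
    using c N.M.add.r_cancel_one[of "f \<zero>\<^bsub>M\<^esub>" "f \<zero>\<^bsub>M\<^esub>"] by simp
qed

lemma rmod_hom_free_eval:
  assumes M: "right_module R M" and N: "right_module R N" and f: "f \<in> rmod_hom R M N"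
    and m: "m \<in> X \<rightarrow> carrier M" and \<phi>: "\<phi> \<in> carrier (free_rmod R X)"
  shows "f (free_eval R M m \<phi>) = free_eval R N (\<lambda>i. f (m i)) \<phi>"
proof -
  interpret M: right_module R M by fact
  interpret N: right_module R N by fact
  have f': "f x \<in> carrier N" if "x \<in> carrier M" for x
    using f that by (auto simp: rmod_hom_def)
  have "f (\<Oplus>\<^bsub>M\<^esub>i\<in>S. m i \<bullet>\<^bsub>M\<^esub> \<phi> i) = (\<Oplus>\<^bsub>N\<^esub>i\<in>S. f (m i) \<bullet>\<^bsub>N\<^esub> \<phi> i)"
    if "finite S" "S \<subseteq> X" for S
    using that
  proof (induction S rule: finite_induct)
    case empty
    then show ?case using rmod_hom_zero[OF M N f] by simp
  next
    case (insert i S)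
    have c: "m j \<in> carrier M" "\<phi> j \<in> carrier R" if "j \<in> insert i S" for j
      using that insert.prems m \<phi> by (auto simp: free_rmod_def)
    have "f (\<Oplus>\<^bsub>M\<^esub>i\<in>insert i S. m i \<bullet>\<^bsub>M\<^esub> \<phi> i)
        = f (m i \<bullet>\<^bsub>M\<^esub> \<phi> i \<oplus>\<^bsub>M\<^esub> (\<Oplus>\<^bsub>M\<^esub>i\<in>S. m i \<bullet>\<^bsub>M\<^esub> \<phi> i))"
      using insert.hyps c by (subst M.M.finsum_insert) auto
    also have "\<dots> = f (m i) \<bullet>\<^bsub>N\<^esub> \<phi> i \<oplus>\<^bsub>N\<^esub> f (\<Oplus>\<^bsub>M\<^esub>i\<in>S. m i \<bullet>\<^bsub>M\<^esub> \<phi> i)"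
    proof -
      have "(\<Oplus>\<^bsub>M\<^esub>i\<in>S. m i \<bullet>\<^bsub>M\<^esub> \<phi> i) \<in> carrier M"
        using c by (intro M.M.finsum_closed) auto
      then show ?thesis using f c by (auto simp: rmod_hom_def)
    qed
    also have "\<dots> = (\<Oplus>\<^bsub>N\<^esub>i\<in>insert i S. f (m i) \<bullet>\<^bsub>N\<^esub> \<phi> i)"
      using insert c f' by (subst N.M.finsum_insert) auto
    finally show ?case .
  qed
  then show ?thesis
    using \<phi> unfolding free_eval_def by (auto simp: free_rmod_def)
qed

theorem projective_rmod_lift:
  fixes M :: "('r, 'a) rmodule" and N :: "('r, 'b) rmodule" and P :: "('r, 'm) rmodule"
  assumes P: "projective_rmod R P" and M: "right_module R M" and N: "right_module R N"
    and g: "g \<in> rmod_hom R M N" and surj: "g ` carrier M = carrier N"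
    and f: "f \<in> rmod_hom R P N"
  shows "\<exists>h\<in>rmod_hom R P M. \<forall>x\<in>carrier P. g (h x) = f x"
proof -
  let ?F = "free_rmod R (carrier P)"
  have PM: "right_module R P" using P by (simp add: projective_rmod_def)
  interpret P: right_module R P by fact
  interpret M: right_module R M by fact
  interpret N: right_module R N by fact
  have FM: "right_module R ?F" by (rule free_rmod_right_module) (rule P.R.ring_axioms)
  let ?p = "free_eval R P (\<lambda>x. x)"
  have p: "?p \<in> rmod_hom R ?F P"
    by (rule free_eval_hom[OF PM]) auto
  have "x \<in> ?p ` carrier ?F" if x: "x \<in> carrier P" for x
  proof
    let ?d = "\<lambda>y. if y = x then \<one>\<^bsub>R\<^esub> else \<zero>\<^bsub>R\<^esub>"
    show d: "?d \<in> carrier ?F"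
      using x by (auto simp: free_rmod_def)
    show "x = ?p ?d"
      using x by (subst free_eval_superset[OF PM _ d, where S = "{x}"]) (auto split: if_splits)
  qed
  then have "?p ` carrier ?F = carrier P"
    using p by (auto simp: rmod_hom_def)
  moreover have "(\<lambda>x. x) \<in> rmod_hom R P P" by (simp add: rmod_hom_def)
  ultimately obtain s where s: "s \<in> rmod_hom R P ?F" "\<And>x. x \<in> carrier P \<Longrightarrow> ?p (s x) = x"
    using P PM FM p unfolding projective_rmod_def by meson
  have "\<exists>m. \<forall>x\<in>carrier P. m x \<in> carrier M \<and> g (m x) = f x"
  proof -
    have "f x \<in> g ` carrier M" if "x \<in> carrier P" for x
      using f that surj by (auto simp: rmod_hom_def)
    then show ?thesis by (intro bchoice) (auto simp: image_iff Bex_def eq_commute)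
  qed
  then obtain m where m: "\<And>x. x \<in> carrier P \<Longrightarrow> m x \<in> carrier M"
      "\<And>x. x \<in> carrier P \<Longrightarrow> g (m x) = f x" by blast
  have e: "free_eval R M m \<in> rmod_hom R ?F M"
    by (rule free_eval_hom[OF M]) (use m in auto)
  show ?thesis
  proof (intro bexI ballI)
    show "(\<lambda>x. free_eval R M m (s x)) \<in> rmod_hom R P M"
      using s(1) e unfolding rmod_hom_def by (auto simp: Pi_iff)
  next
    fix x assume x: "x \<in> carrier P"
    have sx: "s x \<in> carrier ?F" using s(1) x by (auto simp: rmod_hom_def)
    have "g (free_eval R M m (s x)) = free_eval R N (\<lambda>y. g (m y)) (s x)"
      by (rule rmod_hom_free_eval[OF M N g _ sx]) (use m in auto)
    also have "\<dots> = free_eval R N (\<lambda>y. f y) (s x)"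
      unfolding free_eval_def
    proof (rule N.M.finsum_cong')
      fix y assume "y \<in> {i. s x i \<noteq> \<zero>\<^bsub>R\<^esub>}"
      then have "y \<in> carrier P" using sx by (auto simp: free_rmod_def)
      then show "g (m y) \<bullet>\<^bsub>N\<^esub> s x y = f y \<bullet>\<^bsub>N\<^esub> s x y" by (simp add: m)
    qed (use sx f in \<open>auto simp: free_rmod_def rmod_hom_def Pi_iff subset_iff\<close>)
    also have "\<dots> = f (?p (s x))"
      by (rule rmod_hom_free_eval[OF PM N f _ sx, symmetric]) auto
    also have "\<dots> = f x" using s(2)[OF x] by simp
    finally show "g (free_eval R M m (s x)) = f x" .
  qed
qed

end

theory Submission
  imports Defs "HOL-Library.Nat_Bijection"
begin

text \<open>
  Let \<open>F\<close> be a free \<open>R\<close>-module with a map \<open>q\<close> onto \<open>P'\<close>.  The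
  idempotent of \<open>F / F I\<close> with image \<open>P'\<close> lifts to an endomorphism \<open>\<alpha>\<close> of \<open>F\<close>, and \<open>\<alpha> - \<alpha>\<^sup>2\<close> maps into \<open>F I\<close>.
  As \<open>I = Tr(Q)\<close>, it factors as \<open>\<alpha> - \<alpha>\<^sup>2 = \<pi> \<beta>\<close> through a direct sum \<open>L\<close> of copies of \<open>Q\<close>, and
  \<open>L I = L\<close>.  Take for \<open>P\<close> the finitely supported sequences \<open>(X\<^sub>k, Y\<^sub>k)\<close> in \<open>F \<times> L\<close> with
  \<open>X\<^sub>k = \<alpha> X\<^sub>k + \<pi> Y\<^sub>k + X\<^sub>k\<^sub>+\<^sub>1\<close>, mapped onto \<open>P'\<close> by \<open>q X\<^sub>0\<close>; the element with \<open>X\<^sub>0 = \<alpha> x\<close>,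
  \<open>Y\<^sub>0 = \<beta> x\<close> and zeros elsewhere lies over \<open>q x\<close>.  \<open>P\<close> is a direct summand of the module of all
  finitely supported sequences, hence projective.  If \<open>q X\<^sub>0 = 0\<close>, then modulo \<open>F I\<close> all \<open>\<alpha> X\<^sub>k\<close> vanish, so
  the sequence \<open>X\<close> is constant and therefore zero; this identifies the kernel as \<open>P I\<close>.
\<close>

section \<open>Homomorphisms\<close>

text \<open>Idempotents need not lift modulo I, so \<alpha> itself cannot be repaired. Its defect is
  absorbed by L instead, which is harmless because L vanishes modulo I. The one-step attempt is the
  kernel of (x, y) |-> x - \<alpha> x - \<pi> y on F x L: modulo I this map becomes 1 - \<alpha> on
  F / F I, whose kernel is P'. But nothing makes the map onto F, so its kernel may fail to be a
  direct summand. Subtracting one more free term X_1 makes it onto, at the price of an uncontrolled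
  X_1; imposing the same equation on X_1, then on X_2, and so on, leads to sequences. Modulo F I the
  equations read X_(k+1) = (1 - \<alpha>) X_k with 1 - \<alpha> idempotent, so X_1 = X_2 = ... = (1
  - \<alpha>) X_0. Finite support therefore forces (1 - \<alpha>) X_0 = 0, and all that survives is
  X_0 in the image of \<alpha>. Over R itself the system is split by tail sums, which finite support
  also makes meaningful.\<close>

lemma rmod_homI:
  assumes "\<And>x. x \<in> carrier M \<Longrightarrow> f x \<in> carrier N"
    and "\<And>x y. \<lbrakk>x \<in> carrier M; y \<in> carrier M\<rbrakk> \<Longrightarrow> f (x \<oplus>\<^bsub>M\<^esub> y) = f x \<oplus>\<^bsub>N\<^esub> f y"
    and "\<And>x a. \<lbrakk>x \<in> carrier M; a \<in> carrier R\<rbrakk> \<Longrightarrow> f (x \<bullet>\<^bsub>M\<^esub> a) = f x \<bullet>\<^bsub>N\<^esub> a"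
  shows "f \<in> rmod_hom R M N"
  using assms by (auto simp: rmod_hom_def)

lemma rmod_hom_closed: "\<lbrakk>f \<in> rmod_hom R M N; x \<in> carrier M\<rbrakk> \<Longrightarrow> f x \<in> carrier N"
  by (auto simp: rmod_hom_def)

lemma rmod_hom_add:
  "\<lbrakk>f \<in> rmod_hom R M N; x \<in> carrier M; y \<in> carrier M\<rbrakk> \<Longrightarrow> f (x \<oplus>\<^bsub>M\<^esub> y) = f x \<oplus>\<^bsub>N\<^esub> f y"
  by (auto simp: rmod_hom_def)

lemma rmod_hom_ract:
  "\<lbrakk>f \<in> rmod_hom R M N; x \<in> carrier M; a \<in> carrier R\<rbrakk> \<Longrightarrow> f (x \<bullet>\<^bsub>M\<^esub> a) = f x \<bullet>\<^bsub>N\<^esub> a"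
  by (auto simp: rmod_hom_def)

lemma rmod_hom_comp:
  "\<lbrakk>f \<in> rmod_hom R M N; g \<in> rmod_hom R N K\<rbrakk> \<Longrightarrow> (\<lambda>x. g (f x)) \<in> rmod_hom R M K"
  by (auto simp: rmod_hom_def Pi_iff)

lemma rmod_hom_id: "(\<lambda>x. x) \<in> rmod_hom R M M"
  by (auto simp: rmod_hom_def)

lemma rmod_hom_a_inv:
  assumes M: "right_module R M" and N: "right_module R N" and f: "f \<in> rmod_hom R M N"
    and x: "x \<in> carrier M"
  shows "f (\<ominus>\<^bsub>M\<^esub> x) = \<ominus>\<^bsub>N\<^esub> f x"
proof -
  interpret M: right_module R M by fact
  interpret N: right_module R N by fact
  have "f (\<ominus>\<^bsub>M\<^esub> x) \<oplus>\<^bsub>N\<^esub> f x = \<zero>\<^bsub>N\<^esub>"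
    using x f rmod_hom_zero[OF M N f] by (simp add: rmod_hom_add[OF f, symmetric] M.M.l_neg)
  then show ?thesis
    using x f by (simp add: N.M.minus_equality rmod_hom_closed)
qed

lemma rmod_hom_diff:
  assumes M: "right_module R M" and N: "right_module R N" and f: "f \<in> rmod_hom R M N"
    and x: "x \<in> carrier M" and y: "y \<in> carrier M"
  shows "f (x \<ominus>\<^bsub>M\<^esub> y) = f x \<ominus>\<^bsub>N\<^esub> f y"
proof -
  interpret M: right_module R M by fact
  show ?thesis
    using x y by (simp add: a_minus_def rmod_hom_add[OF f] rmod_hom_a_inv[OF M N f])
qed

lemma (in right_module) a_inv_ract:
  assumes "x \<in> carrier M" "a \<in> carrier R"
  shows "(\<ominus>\<^bsub>M\<^esub> x) \<bullet>\<^bsub>M\<^esub> a = \<ominus>\<^bsub>M\<^esub> (x \<bullet>\<^bsub>M\<^esub> a)"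
  using assms by (intro M.minus_equality[symmetric]) (auto simp: ract_l_distr[symmetric] M.l_neg)

lemma (in right_module) minus_ract:
  assumes "x \<in> carrier M" "y \<in> carrier M" "a \<in> carrier R"
  shows "(x \<ominus>\<^bsub>M\<^esub> y) \<bullet>\<^bsub>M\<^esub> a = x \<bullet>\<^bsub>M\<^esub> a \<ominus>\<^bsub>M\<^esub> y \<bullet>\<^bsub>M\<^esub> a"
  using assms by (simp add: a_minus_def ract_l_distr a_inv_ract)

context
  fixes R :: "('r, 'x) ring_scheme" and M :: "('r, 'm) rmodule"
  assumes M: "right_module R M"
begin

interpretation right_module R M by (rule M)

lemma rmod_hom_plus:
  assumes "f \<in> rmod_hom R K M" "g \<in> rmod_hom R K M"
  shows "(\<lambda>x. f x \<oplus>\<^bsub>M\<^esub> g x) \<in> rmod_hom R K M"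
  using assms
  by (intro rmod_homI)
     (auto simp: rmod_hom_closed rmod_hom_add rmod_hom_ract ract_l_distr M.a_ac)

lemma rmod_hom_minus:
  assumes "f \<in> rmod_hom R K M" "g \<in> rmod_hom R K M"
  shows "(\<lambda>x. f x \<ominus>\<^bsub>M\<^esub> g x) \<in> rmod_hom R K M"
proof (rule rmod_homI)
  fix x y assume "x \<in> carrier K" "y \<in> carrier K"
  then show "f (x \<oplus>\<^bsub>K\<^esub> y) \<ominus>\<^bsub>M\<^esub> g (x \<oplus>\<^bsub>K\<^esub> y) = (f x \<ominus>\<^bsub>M\<^esub> g x) \<oplus>\<^bsub>M\<^esub> (f y \<ominus>\<^bsub>M\<^esub> g y)"
    using assms
    by (simp add: rmod_hom_closed rmod_hom_add a_minus_def M.minus_add M.a_ac)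
qed (use assms in \<open>simp_all add: rmod_hom_closed rmod_hom_ract minus_ract\<close>)

lemma rmod_hom_const_zero: "(\<lambda>x. \<zero>\<^bsub>M\<^esub>) \<in> rmod_hom R K M"
  by (intro rmod_homI) auto

lemma ract_hom_regular:
  "m \<in> carrier M \<Longrightarrow> (\<lambda>a. m \<bullet>\<^bsub>M\<^esub> a) \<in> rmod_hom R (regular_rmod R) M"
  by (intro rmod_homI) (auto simp: regular_rmod_def ract_r_distr ract_assoc)

end

lemma regular_rmod_sel [simp]:
  "carrier (regular_rmod R) = carrier R" "add (regular_rmod R) = add R"
  "zero (regular_rmod R) = zero R" "ract (regular_rmod R) = mult R"
  by (simp_all add: regular_rmod_def)

lemma regular_rmod_right_module:
  assumes "ring R"
  shows "right_module R (regular_rmod R)"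
proof -
  interpret ring R by fact
  have "abelian_group (regular_rmod R)"
    by (rule abelian_groupI) (auto simp: a_ac intro: l_neg bexI[of _ "\<ominus>\<^bsub>R\<^esub> _"])
  then show ?thesis
    by (intro right_module.intro right_module_axioms.intro assms)
       (auto simp: l_distr r_distr m_assoc)
qed

section \<open>The submodule generated by an ideal\<close>

context
  fixes R :: "('r, 'x) ring_scheme" and M :: "('r, 'm) rmodule"
  assumes M: "right_module R M"
begin

interpretation right_module R M by (rule M)

lemma mult_ideal_subgroup:
  assumes "I \<subseteq> carrier R"
  shows "subgroup (rmod_mult_ideal M I) (add_monoid M)"
  unfolding rmod_mult_ideal_def using assms
  by (intro M.add.generate_is_subgroup) auto

lemma mult_ideal_closed:
  assumes "I \<subseteq> carrier R"
  shows "\<zero>\<^bsub>M\<^esub> \<in> rmod_mult_ideal M I"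
    and "x \<in> rmod_mult_ideal M I \<Longrightarrow> x \<in> carrier M"
    and "\<lbrakk>x \<in> rmod_mult_ideal M I; y \<in> rmod_mult_ideal M I\<rbrakk> \<Longrightarrow> x \<oplus>\<^bsub>M\<^esub> y \<in> rmod_mult_ideal M I"
    and "x \<in> rmod_mult_ideal M I \<Longrightarrow> \<ominus>\<^bsub>M\<^esub> x \<in> rmod_mult_ideal M I"
proof -
  interpret S: subgroup "rmod_mult_ideal M I" "add_monoid M"
    by (rule mult_ideal_subgroup) fact
  show "\<zero>\<^bsub>M\<^esub> \<in> rmod_mult_ideal M I" "x \<in> rmod_mult_ideal M I \<Longrightarrow> x \<in> carrier M"
    using S.one_closed S.mem_carrier by auto
  show "x \<oplus>\<^bsub>M\<^esub> y \<in> rmod_mult_ideal M I"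
    if "x \<in> rmod_mult_ideal M I" "y \<in> rmod_mult_ideal M I" for x y
    using S.m_closed that by auto
  show "\<ominus>\<^bsub>M\<^esub> x \<in> rmod_mult_ideal M I" if "x \<in> rmod_mult_ideal M I" for x
    using S.m_inv_closed[OF that] by (simp add: a_inv_def)
qed

end

lemma mult_ideal_incl: "\<lbrakk>x \<in> carrier M; a \<in> I\<rbrakk> \<Longrightarrow> x \<bullet>\<^bsub>M\<^esub> a \<in> rmod_mult_ideal M I"
  unfolding rmod_mult_ideal_def by (rule generate.incl) auto

lemma mult_ideal_induct [consumes 3, case_names subset zero gen a_inv add]:
  assumes M: "right_module R M" and "I \<subseteq> carrier R" and x: "x \<in> rmod_mult_ideal M I"
    and S: "S \<subseteq> carrier M" "\<zero>\<^bsub>M\<^esub> \<in> S"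
    and gen: "\<And>x a. \<lbrakk>x \<in> carrier M; a \<in> I\<rbrakk> \<Longrightarrow> x \<bullet>\<^bsub>M\<^esub> a \<in> S"
    and inv: "\<And>x. x \<in> S \<Longrightarrow> \<ominus>\<^bsub>M\<^esub> x \<in> S"
    and add: "\<And>x y. \<lbrakk>x \<in> S; y \<in> S\<rbrakk> \<Longrightarrow> x \<oplus>\<^bsub>M\<^esub> y \<in> S"
  shows "x \<in> S"
proof -
  interpret M: right_module R M by fact
  have "subgroup S (add_monoid M)"
    using S inv add by (intro M.M.add.subgroupI) (auto simp: a_inv_def)
  then have "rmod_mult_ideal M I \<subseteq> S"
    unfolding rmod_mult_ideal_def using gen
    by (intro M.M.add.generate_subgroup_incl) auto
  then show ?thesis using x by blast
qed

lemma rmod_hom_mult_ideal: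
  assumes M: "right_module R M" and N: "right_module R N" and f: "f \<in> rmod_hom R M N"
    and I: "I \<subseteq> carrier R" and x: "x \<in> rmod_mult_ideal M I"
  shows "f x \<in> rmod_mult_ideal N I"
proof -
  interpret M: right_module R M by fact
  interpret N: right_module R N by fact
  let ?S = "{x \<in> carrier M. f x \<in> rmod_mult_ideal N I}"
  note cl = mult_ideal_closed[OF N I]
  have "x \<in> ?S"
    using M I x
  proof (induction rule: mult_ideal_induct)
    case (gen x a)
    then have "f (x \<bullet>\<^bsub>M\<^esub> a) = f x \<bullet>\<^bsub>N\<^esub> a" "x \<bullet>\<^bsub>M\<^esub> a \<in> carrier M"
      using I f by (auto intro: rmod_hom_ract)
    moreover have "f x \<bullet>\<^bsub>N\<^esub> a \<in> rmod_mult_ideal N I"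
      using gen f by (intro mult_ideal_incl) (auto simp: rmod_hom_closed)
    ultimately show ?case by auto
  qed (use cl in \<open>auto simp: rmod_hom_zero[OF M N f] rmod_hom_a_inv[OF M N f] rmod_hom_add[OF f]\<close>)
  then show ?thesis by auto
qed

section \<open>Finitely supported families\<close>

text \<open>The direct sum of copies of \<open>M\<close> indexed by a whole type, so that no index
  set has to be carried along. Over \<open>regular_rmod R\<close> it is the free module on that
  type.\<close>

definition fin_rmod :: "('r, 'm) rmodule \<Rightarrow> ('r, 'i \<Rightarrow> 'm) rmodule" where
  "fin_rmod M =
     \<lparr>carrier = {\<phi>. (\<forall>i. \<phi> i \<in> carrier M) \<and> finite {i. \<phi> i \<noteq> \<zero>\<^bsub>M\<^esub>}},
      mult = undefined, one = undefined,
      zero = (\<lambda>i. \<zero>\<^bsub>M\<^esub>), add = (\<lambda>\<phi> \<psi> i. \<phi> i \<oplus>\<^bsub>M\<^esub> \<psi> i), ract = (\<lambda>\<phi> a i. \<phi> i \<bullet>\<^bsub>M\<^esub> a)\<rparr>"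

lemma fin_rmod_sel:
  "\<phi> \<in> carrier (fin_rmod M) \<longleftrightarrow> (\<forall>i. \<phi> i \<in> carrier M) \<and> finite {i. \<phi> i \<noteq> \<zero>\<^bsub>M\<^esub>}"
  "\<zero>\<^bsub>fin_rmod M\<^esub> = (\<lambda>i. \<zero>\<^bsub>M\<^esub>)"
  "\<phi> \<oplus>\<^bsub>fin_rmod M\<^esub> \<psi> = (\<lambda>i. \<phi> i \<oplus>\<^bsub>M\<^esub> \<psi> i)"
  "\<phi> \<bullet>\<^bsub>fin_rmod M\<^esub> a = (\<lambda>i. \<phi> i \<bullet>\<^bsub>M\<^esub> a)"
  by (simp_all add: fin_rmod_def)

lemma fin_rmod_right_module:
  assumes "right_module R M"
  shows "right_module R (fin_rmod M :: ('r, 'i \<Rightarrow> 'm) rmodule)"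
proof -
  interpret right_module R M by fact
  have "abelian_group (fin_rmod M :: ('r, 'i \<Rightarrow> 'm) rmodule)"
  proof (rule abelian_groupI)
    fix \<phi> \<psi> :: "'i \<Rightarrow> 'm"
    assume "\<phi> \<in> carrier (fin_rmod M)" "\<psi> \<in> carrier (fin_rmod M)"
    moreover have "{i. \<phi> i \<oplus>\<^bsub>M\<^esub> \<psi> i \<noteq> \<zero>\<^bsub>M\<^esub>} \<subseteq> {i. \<phi> i \<noteq> \<zero>\<^bsub>M\<^esub>} \<union> {i. \<psi> i \<noteq> \<zero>\<^bsub>M\<^esub>}"
      by auto
    ultimately show "\<phi> \<oplus>\<^bsub>fin_rmod M\<^esub> \<psi> \<in> carrier (fin_rmod M)"
      by (auto simp: fin_rmod_sel intro: finite_subset)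
  next
    fix \<phi> :: "'i \<Rightarrow> 'm" assume \<phi>: "\<phi> \<in> carrier (fin_rmod M)"
    then have eq: "{i. \<ominus>\<^bsub>M\<^esub> \<phi> i \<noteq> \<zero>\<^bsub>M\<^esub>} = {i. \<phi> i \<noteq> \<zero>\<^bsub>M\<^esub>}"
      by (auto simp: fin_rmod_sel)
    show "\<exists>\<psi>\<in>carrier (fin_rmod M). \<psi> \<oplus>\<^bsub>fin_rmod M\<^esub> \<phi> = \<zero>\<^bsub>fin_rmod M\<^esub>"
      using \<phi> eq by (intro bexI[of _ "\<lambda>i. \<ominus>\<^bsub>M\<^esub> \<phi> i"]) (auto simp: fin_rmod_sel M.l_neg)
  qed (auto simp: fin_rmod_sel M.a_assoc M.a_comm M.a_lcomm fun_eq_iff)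
  moreover have "(\<lambda>i. \<phi> i \<bullet>\<^bsub>M\<^esub> a) \<in> carrier (fin_rmod M)"
    if "\<phi> \<in> carrier (fin_rmod M)" "a \<in> carrier R" for \<phi> :: "'i \<Rightarrow> 'm" and a
  proof -
    have "{i. \<phi> i \<bullet>\<^bsub>M\<^esub> a \<noteq> \<zero>\<^bsub>M\<^esub>} \<subseteq> {i. \<phi> i \<noteq> \<zero>\<^bsub>M\<^esub>}" using that by auto
    then show ?thesis using that by (auto simp: fin_rmod_sel intro: finite_subset)
  qed
  ultimately show ?thesis
    by (intro right_module.intro right_module_axioms.intro R.ring_axioms)
       (auto simp: fin_rmod_sel ract_l_distr ract_r_distr ract_assoc fun_eq_iff)
qed

definition single :: "('r, 'm) rmodule \<Rightarrow> 'i \<Rightarrow> 'm \<Rightarrow> 'i \<Rightarrow> 'm" where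
  "single M i x = (\<lambda>j. if j = i then x else \<zero>\<^bsub>M\<^esub>)"

lemma single_hom:
  assumes "right_module R M"
  shows "single M i \<in> rmod_hom R M (fin_rmod M)"
proof -
  interpret right_module R M by fact
  have "finite {j. single M i x j \<noteq> \<zero>\<^bsub>M\<^esub>}" for x
    by (rule finite_subset[of _ "{i}"]) (auto simp: single_def)
  then show ?thesis
    by (intro rmod_homI) (auto simp: fin_rmod_sel single_def fun_eq_iff)
qed

lemma proj_hom: "(\<lambda>\<phi>. \<phi> i) \<in> rmod_hom R (fin_rmod M) M"
  by (intro rmod_homI) (auto simp: fin_rmod_sel)

text \<open>The last premise asks only for the coordinates of the given \<phi>, so that hypotheses
  on these particular coordinates can enter an induction.\<close>

lemma fin_rmod_induct [consumes 2, case_names zero add single]: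
  assumes M: "right_module R M" and \<phi>: "\<phi> \<in> carrier (fin_rmod M)"
    and zero: "\<zero>\<^bsub>fin_rmod M\<^esub> \<in> A"
    and add: "\<And>\<phi> \<psi>. \<lbrakk>\<phi> \<in> A; \<psi> \<in> A\<rbrakk> \<Longrightarrow> \<phi> \<oplus>\<^bsub>fin_rmod M\<^esub> \<psi> \<in> A"
    and single: "\<And>i. single M i (\<phi> i) \<in> A"
  shows "\<phi> \<in> A"
proof -
  interpret right_module R M by fact
  have "(\<lambda>i. if i \<in> S then \<phi> i else \<zero>\<^bsub>M\<^esub>) \<in> A" if "finite S" for S
    using that
  proof (induction S rule: finite_induct)
    case empty
    then show ?case using zero by (simp add: fin_rmod_sel)
  next
    case (insert k S)
    have "(\<lambda>i. if i \<in> insert k S then \<phi> i else \<zero>\<^bsub>M\<^esub>)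
        = single M k (\<phi> k) \<oplus>\<^bsub>fin_rmod M\<^esub> (\<lambda>i. if i \<in> S then \<phi> i else \<zero>\<^bsub>M\<^esub>)"
      using insert.hyps \<phi> by (auto simp: fin_rmod_sel single_def fun_eq_iff)
    then show ?case using add[OF single insert.IH] by simp
  qed
  from this[of "{i. \<phi> i \<noteq> \<zero>\<^bsub>M\<^esub>}"]
  have "(\<lambda>i. if i \<in> {i. \<phi> i \<noteq> \<zero>\<^bsub>M\<^esub>} then \<phi> i else \<zero>\<^bsub>M\<^esub>) \<in> A"
    using \<phi> by (simp only: fin_rmod_sel)
  moreover have "(\<lambda>i. if i \<in> {i. \<phi> i \<noteq> \<zero>\<^bsub>M\<^esub>} then \<phi> i else \<zero>\<^bsub>M\<^esub>) = \<phi>"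
    by auto
  ultimately show ?thesis by simp
qed

lemma fin_rmod_hom_ext:
  fixes R :: "('r, 'x) ring_scheme" and \<phi> :: "'i \<Rightarrow> 'm"
  assumes M: "right_module R M" and N: "right_module R N"
    and f: "f \<in> rmod_hom R (fin_rmod M) N" and g: "g \<in> rmod_hom R (fin_rmod M) N"
    and eq: "\<And>i x. x \<in> carrier M \<Longrightarrow> f (single M i x) = g (single M i x)"
    and \<phi>: "\<phi> \<in> carrier (fin_rmod M)"
  shows "f \<phi> = g \<phi>"
proof -
  let ?F = "fin_rmod M :: ('r, 'i \<Rightarrow> 'm) rmodule"
  have F: "right_module R ?F" by (rule fin_rmod_right_module[OF M])
  interpret F: right_module R ?F by fact
  have "\<phi> \<in> {\<phi> \<in> carrier ?F. f \<phi> = g \<phi>}"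
    using M \<phi>
  proof (induction rule: fin_rmod_induct)
    case (single i)
    have "\<phi> i \<in> carrier M" using \<phi> by (simp add: fin_rmod_sel)
    then show ?case using eq rmod_hom_closed[OF single_hom[OF M]] by auto
  qed (auto simp: rmod_hom_zero[OF F N f] rmod_hom_zero[OF F N g] rmod_hom_add[OF f] rmod_hom_add[OF g])
  then show ?thesis by simp
qed

text \<open>Each embedding \<open>single M i\<close> carries M I into the submodule generated by I
  in the direct sum, and \<phi> is a finite sum of such images.\<close>

lemma fin_rmod_mult_ideal:
  fixes R :: "('r, 'x) ring_scheme" and \<phi> :: "'i \<Rightarrow> 'm"
  assumes M: "right_module R M" and I: "I \<subseteq> carrier R"
    and \<phi>: "\<phi> \<in> carrier (fin_rmod M)" and "\<And>i. \<phi> i \<in> rmod_mult_ideal M I"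
  shows "\<phi> \<in> rmod_mult_ideal (fin_rmod M) I"
proof -
  let ?F = "fin_rmod M :: ('r, 'i \<Rightarrow> 'm) rmodule"
  have F: "right_module R ?F" by (rule fin_rmod_right_module[OF M])
  interpret F: right_module R ?F by fact
  show ?thesis
    using M \<phi>
    by (induction rule: fin_rmod_induct)
       (use assms mult_ideal_closed[OF F I] rmod_hom_mult_ideal[OF M F single_hom[OF M] I] in auto)
qed

text \<open>The map out of the direct sum that the universal property attaches to the family
  \<open>h\<close>.\<close>

definition fin_eval ::
    "('r, 'm) rmodule \<Rightarrow> ('r, 'n) rmodule \<Rightarrow> ('i \<Rightarrow> 'm \<Rightarrow> 'n) \<Rightarrow> ('i \<Rightarrow> 'm) \<Rightarrow> 'n" where
  "fin_eval M N h \<phi> = (\<Oplus>\<^bsub>N\<^esub>i\<in>{i. \<phi> i \<noteq> \<zero>\<^bsub>M\<^esub>}. h i (\<phi> i))"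

lemma fin_eval_superset:
  assumes M: "right_module R M" and N: "right_module R N" and h: "\<And>i. h i \<in> rmod_hom R M N"
    and \<phi>: "\<phi> \<in> carrier (fin_rmod M)" and S: "finite S" "{i. \<phi> i \<noteq> \<zero>\<^bsub>M\<^esub>} \<subseteq> S"
  shows "fin_eval M N h \<phi> = (\<Oplus>\<^bsub>N\<^esub>i\<in>S. h i (\<phi> i))"
proof -
  interpret N: right_module R N by fact
  show ?thesis
    unfolding fin_eval_def
    by (rule N.M.add.finprod_mono_neutral_cong_left)
       (use S \<phi> in \<open>auto simp: fin_rmod_sel rmod_hom_zero[OF M N h] rmod_hom_closed[OF h]\<close>)
qed

lemma fin_eval_hom:
  fixes R :: "('r, 'x) ring_scheme" and h :: "'i \<Rightarrow> 'm \<Rightarrow> 'n"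
  assumes M: "right_module R M" and N: "right_module R N" and h: "\<And>i. h i \<in> rmod_hom R M N"
  shows "fin_eval M N h \<in> rmod_hom R (fin_rmod M) N"
proof (rule rmod_homI)
  interpret M: right_module R M by fact
  interpret N: right_module R N by fact
  let ?F = "fin_rmod M :: ('r, 'i \<Rightarrow> 'm) rmodule"
  interpret F: right_module R ?F by (rule fin_rmod_right_module[OF M])
  note sup = fin_eval_superset[where h = h, OF M N h]
  fix \<phi> assume \<phi>: "\<phi> \<in> carrier ?F"
  let ?S = "{i. \<phi> i \<noteq> \<zero>\<^bsub>M\<^esub>}"
  have c: "\<phi> i \<in> carrier M" "finite ?S" for i using \<phi> by (auto simp: fin_rmod_sel)
  show "fin_eval M N h \<phi> \<in> carrier N"
    unfolding fin_eval_def using c h by (intro N.M.finsum_closed) (auto simp: rmod_hom_closed[OF h])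
  {
    fix \<psi> assume \<psi>: "\<psi> \<in> carrier ?F"
    let ?T = "?S \<union> {i. \<psi> i \<noteq> \<zero>\<^bsub>M\<^esub>}"
    have d: "\<psi> i \<in> carrier M" "finite ?T" for i using \<phi> \<psi> by (auto simp: fin_rmod_sel)
    have "fin_eval M N h (\<phi> \<oplus>\<^bsub>?F\<^esub> \<psi>) = (\<Oplus>\<^bsub>N\<^esub>i\<in>?T. h i (\<phi> i \<oplus>\<^bsub>M\<^esub> \<psi> i))"
      by (subst sup[of _ ?T]) (use F.M.a_closed[OF \<phi> \<psi>] d in \<open>auto simp: fin_rmod_sel(3)\<close>)
    also have "\<dots> = (\<Oplus>\<^bsub>N\<^esub>i\<in>?T. h i (\<phi> i) \<oplus>\<^bsub>N\<^esub> h i (\<psi> i))"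
      by (rule N.M.finsum_cong') (use c d h in \<open>auto simp: rmod_hom_closed[OF h] rmod_hom_add[OF h]\<close>)
    also have "\<dots> = (\<Oplus>\<^bsub>N\<^esub>i\<in>?T. h i (\<phi> i)) \<oplus>\<^bsub>N\<^esub> (\<Oplus>\<^bsub>N\<^esub>i\<in>?T. h i (\<psi> i))"
      by (rule N.M.finsum_addf) (use c d h in \<open>auto simp: rmod_hom_closed[OF h]\<close>)
    finally show "fin_eval M N h (\<phi> \<oplus>\<^bsub>?F\<^esub> \<psi>) = fin_eval M N h \<phi> \<oplus>\<^bsub>N\<^esub> fin_eval M N h \<psi>"
      using sup[OF \<phi> d(2)] sup[OF \<psi> d(2)] by auto
  }
  fix a assume a: "a \<in> carrier R"
  have "fin_eval M N h (\<phi> \<bullet>\<^bsub>?F\<^esub> a) = (\<Oplus>\<^bsub>N\<^esub>i\<in>?S. h i (\<phi> i \<bullet>\<^bsub>M\<^esub> a))"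
    by (subst sup[of _ ?S]) (use F.ract_closed[OF \<phi> a] a c in \<open>auto simp: fin_rmod_sel(4)\<close>)
  also have "\<dots> = (\<Oplus>\<^bsub>N\<^esub>i\<in>?S. h i (\<phi> i) \<bullet>\<^bsub>N\<^esub> a)"
    by (rule N.M.finsum_cong') (use c a h in \<open>auto simp: rmod_hom_closed[OF h] rmod_hom_ract[OF h]\<close>)
  also have "\<dots> = fin_eval M N h \<phi> \<bullet>\<^bsub>N\<^esub> a"
    unfolding fin_eval_def
    by (rule N.finsum_ract[symmetric]) (use c a h in \<open>auto simp: rmod_hom_closed[OF h]\<close>)
  finally show "fin_eval M N h (\<phi> \<bullet>\<^bsub>?F\<^esub> a) = fin_eval M N h \<phi> \<bullet>\<^bsub>N\<^esub> a" .
qed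

lemma fin_eval_single:
  assumes M: "right_module R M" and N: "right_module R N" and h: "\<And>i. h i \<in> rmod_hom R M N"
    and x: "x \<in> carrier M"
  shows "fin_eval M N h (single M i x) = h i x"
proof -
  interpret N: right_module R N by fact
  have "fin_eval M N h (single M i x) = (\<Oplus>\<^bsub>N\<^esub>j\<in>{i}. h j (single M i x j))"
    by (rule fin_eval_superset[OF M N h])
       (use rmod_hom_closed[OF single_hom[OF M] x] in \<open>auto simp: single_def\<close>)
  also have "\<dots> = h i x"
    using rmod_hom_closed[OF h x] by (simp add: single_def)
  finally show ?thesis .
qed

section \<open>Pairs\<close>

definition prod_rmod :: "('r, 'm) rmodule \<Rightarrow> ('r, 'n) rmodule \<Rightarrow> ('r, 'm \<times> 'n) rmodule" where
  "prod_rmod M N =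
     \<lparr>carrier = carrier M \<times> carrier N, mult = undefined, one = undefined,
      zero = (\<zero>\<^bsub>M\<^esub>, \<zero>\<^bsub>N\<^esub>), add = (\<lambda>x y. (fst x \<oplus>\<^bsub>M\<^esub> fst y, snd x \<oplus>\<^bsub>N\<^esub> snd y)),
      ract = (\<lambda>x a. (fst x \<bullet>\<^bsub>M\<^esub> a, snd x \<bullet>\<^bsub>N\<^esub> a))\<rparr>"

lemma prod_rmod_sel [simp]:
  "x \<in> carrier (prod_rmod M N) \<longleftrightarrow> fst x \<in> carrier M \<and> snd x \<in> carrier N"
  "\<zero>\<^bsub>prod_rmod M N\<^esub> = (\<zero>\<^bsub>M\<^esub>, \<zero>\<^bsub>N\<^esub>)"
  "x \<oplus>\<^bsub>prod_rmod M N\<^esub> y = (fst x \<oplus>\<^bsub>M\<^esub> fst y, snd x \<oplus>\<^bsub>N\<^esub> snd y)"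
  "x \<bullet>\<^bsub>prod_rmod M N\<^esub> a = (fst x \<bullet>\<^bsub>M\<^esub> a, snd x \<bullet>\<^bsub>N\<^esub> a)"
  by (auto simp: prod_rmod_def mem_Times_iff)

lemma prod_rmod_right_module:
  assumes "right_module R M" "right_module R N"
  shows "right_module R (prod_rmod M N)"
proof -
  interpret M: right_module R M by fact
  interpret N: right_module R N by fact
  have "abelian_group (prod_rmod M N)"
  proof (rule abelian_groupI)
    fix x assume "x \<in> carrier (prod_rmod M N)"
    then show "\<exists>y\<in>carrier (prod_rmod M N). y \<oplus>\<^bsub>prod_rmod M N\<^esub> x = \<zero>\<^bsub>prod_rmod M N\<^esub>"
      by (intro bexI[of _ "(\<ominus>\<^bsub>M\<^esub> fst x, \<ominus>\<^bsub>N\<^esub> snd x)"]) (auto simp: M.M.l_neg N.M.l_neg)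
  qed (auto simp: M.M.a_ac N.M.a_ac)
  then show ?thesis
    by (intro right_module.intro right_module_axioms.intro M.R.ring_axioms)
       (auto simp: M.ract_l_distr M.ract_r_distr M.ract_assoc N.ract_l_distr N.ract_r_distr N.ract_assoc)
qed

lemma fst_hom: "fst \<in> rmod_hom R (prod_rmod M N) M"
  and snd_hom: "snd \<in> rmod_hom R (prod_rmod M N) N"
  by (auto intro!: rmod_homI)

lemma inl_hom: "right_module R N \<Longrightarrow> (\<lambda>x. (x, \<zero>\<^bsub>N\<^esub>)) \<in> rmod_hom R M (prod_rmod M N)"
proof -
  assume "right_module R N"
  then interpret N: right_module R N .
  show ?thesis by (auto intro!: rmod_homI)
qed

lemma inr_hom: "right_module R M \<Longrightarrow> (\<lambda>y. (\<zero>\<^bsub>M\<^esub>, y)) \<in> rmod_hom R N (prod_rmod M N)"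
proof -
  assume "right_module R M"
  then interpret M: right_module R M .
  show ?thesis by (auto intro!: rmod_homI)
qed

lemma prod_rmod_mult_ideal:
  assumes M: "right_module R M" and N: "right_module R N" and I: "I \<subseteq> carrier R"
    and "x \<in> rmod_mult_ideal M I" "y \<in> rmod_mult_ideal N I"
  shows "(x, y) \<in> rmod_mult_ideal (prod_rmod M N) I"
proof -
  interpret M: right_module R M by fact
  interpret N: right_module R N by fact
  have P: "right_module R (prod_rmod M N)" by (rule prod_rmod_right_module[OF M N])
  interpret P: right_module R "prod_rmod M N" by fact
  have "(x, \<zero>\<^bsub>N\<^esub>) \<oplus>\<^bsub>prod_rmod M N\<^esub> (\<zero>\<^bsub>M\<^esub>, y) \<in> rmod_mult_ideal (prod_rmod M N) I"
    using assms by (intro mult_ideal_closed(3)[OF P I] rmod_hom_mult_ideal[OF M P inl_hom[OF N]]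
      rmod_hom_mult_ideal[OF N P inr_hom[OF M]])
  then show ?thesis
    using assms mult_ideal_closed(2)[OF M I] mult_ideal_closed(2)[OF N I] by simp
qed

lemma fin_map_hom:
  fixes R :: "('r, 'x) ring_scheme" and f :: "'m \<Rightarrow> 'n"
  assumes M: "right_module R M" and N: "right_module R N" and f: "f \<in> rmod_hom R M N"
  shows "(\<lambda>\<phi> i. f (\<phi> i)) \<in> rmod_hom R (fin_rmod M :: ('r, 'i \<Rightarrow> 'm) rmodule) (fin_rmod N)"
proof (rule rmod_homI)
  fix \<phi> :: "'i \<Rightarrow> 'm" assume \<phi>: "\<phi> \<in> carrier (fin_rmod M)"
  then have c: "\<phi> i \<in> carrier M" for i by (simp add: fin_rmod_sel)
  have "{i. f (\<phi> i) \<noteq> \<zero>\<^bsub>N\<^esub>} \<subseteq> {i. \<phi> i \<noteq> \<zero>\<^bsub>M\<^esub>}"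
    using rmod_hom_zero[OF M N f] by auto
  then show "(\<lambda>i. f (\<phi> i)) \<in> carrier (fin_rmod N)"
    using \<phi> c rmod_hom_closed[OF f] by (auto simp: fin_rmod_sel intro: finite_subset)
qed (auto simp: fin_rmod_sel rmod_hom_add[OF f] rmod_hom_ract[OF f])

lemma fin_pair_hom:
  assumes f: "f \<in> rmod_hom R K (fin_rmod M)" and g: "g \<in> rmod_hom R K (fin_rmod N)"
  shows "(\<lambda>x i. (f x i, g x i)) \<in> rmod_hom R K (fin_rmod (prod_rmod M N))"
proof (rule rmod_homI)
  fix x assume x: "x \<in> carrier K"
  have "{i. (f x i, g x i) \<noteq> \<zero>\<^bsub>prod_rmod M N\<^esub>} \<subseteq> {i. f x i \<noteq> \<zero>\<^bsub>M\<^esub>} \<union> {i. g x i \<noteq> \<zero>\<^bsub>N\<^esub>}"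
    by auto
  then show "(\<lambda>i. (f x i, g x i)) \<in> carrier (fin_rmod (prod_rmod M N))"
    using rmod_hom_closed[OF f x] rmod_hom_closed[OF g x]
    by (auto simp: fin_rmod_sel(1) simp del: prod_rmod_sel(2) intro: finite_subset)
qed (auto simp: fin_rmod_sel rmod_hom_add[OF f] rmod_hom_ract[OF f] rmod_hom_add[OF g] rmod_hom_ract[OF g])

section \<open>Lifting along a fixed map\<close>

text \<open>The lifting problem is a parameter because projectivity at all types is not a predicate of HOL;
  lemmas about it are polymorphic in the types of \<open>M\<close> and \<open>N\<close>.\<close>

definition lifts ::
    "('r, 'x) ring_scheme \<Rightarrow> ('r, 'p) rmodule \<Rightarrow> ('r, 'm) rmodule \<Rightarrow> ('r, 'n) rmodule \<Rightarrow> ('m \<Rightarrow> 'n) \<Rightarrow> bool"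
  where "lifts R P M N g \<longleftrightarrow>
    (\<forall>f\<in>rmod_hom R P N. \<exists>h\<in>rmod_hom R P M. \<forall>x\<in>carrier P. g (h x) = f x)"

text \<open>R is free on its unit: any preimage m of f(1) gives the lift a |-> m a.\<close>

lemma lifts_regular:
  assumes M: "right_module R M" and N: "right_module R N" and g: "g \<in> rmod_hom R M N"
    and surj: "g ` carrier M = carrier N"
  shows "lifts R (regular_rmod R) M N g"
  unfolding lifts_def
proof
  interpret M: right_module R M by fact
  interpret N: right_module R N by fact
  fix f assume f: "f \<in> rmod_hom R (regular_rmod R) N"
  have "f \<one>\<^bsub>R\<^esub> \<in> carrier N" using f by (auto intro: rmod_hom_closed)
  then obtain m where m: "m \<in> carrier M" "g m = f \<one>\<^bsub>R\<^esub>" using surj by (metis imageE)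
  have "g (m \<bullet>\<^bsub>M\<^esub> a) = f a" if "a \<in> carrier R" for a
    using rmod_hom_ract[OF g m(1) that] rmod_hom_ract[OF f, of "\<one>\<^bsub>R\<^esub>" a] that by (simp add: m)
  then show "\<exists>h\<in>rmod_hom R (regular_rmod R) M. \<forall>x\<in>carrier (regular_rmod R). g (h x) = f x"
    using ract_hom_regular[OF M m(1)] by (intro bexI) auto
qed

text \<open>Lift on each copy of \<open>P\<close> separately and assemble the lifts by
  \<open>fin_eval\<close>; two maps that agree on every \<open>single\<close> are equal.\<close>

lemma lifts_fin:
  assumes P: "right_module R P" and M: "right_module R M" and N: "right_module R N"
    and g: "g \<in> rmod_hom R M N" and l: "lifts R P M N g"
  shows "lifts R (fin_rmod P) M N g"
  unfolding lifts_def
proof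
  fix f assume f: "f \<in> rmod_hom R (fin_rmod P) N"
  have "\<exists>h. h \<in> rmod_hom R P M \<and> (\<forall>x\<in>carrier P. g (h x) = f (single P i x))" for i
    using l rmod_hom_comp[OF single_hom[OF P] f, of i] unfolding lifts_def by auto
  then obtain h where h: "\<And>i. h i \<in> rmod_hom R P M"
      "\<And>i x. x \<in> carrier P \<Longrightarrow> g (h i x) = f (single P i x)" by metis
  have e: "fin_eval P M h \<in> rmod_hom R (fin_rmod P) M" by (rule fin_eval_hom[OF P M h(1)])
  have "g (fin_eval P M h \<phi>) = f \<phi>" if "\<phi> \<in> carrier (fin_rmod P)" for \<phi>
    by (rule fin_rmod_hom_ext[OF P N rmod_hom_comp[OF e g] f _ that])
       (simp add: fin_eval_single[OF P M h(1)] h(2))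
  then show "\<exists>h\<in>rmod_hom R (fin_rmod P) M. \<forall>x\<in>carrier (fin_rmod P). g (h x) = f x"
    using e by (intro bexI[of _ "fin_eval P M h"]) auto
qed

lemma lifts_prod:
  assumes P: "right_module R P" and Q: "right_module R Q"
    and M: "right_module R M" and N: "right_module R N"
    and g: "g \<in> rmod_hom R M N" and lP: "lifts R P M N g" and lQ: "lifts R Q M N g"
  shows "lifts R (prod_rmod P Q) M N g"
  unfolding lifts_def
proof
  interpret P: right_module R P by fact
  interpret Q: right_module R Q by fact
  interpret M: right_module R M by fact
  interpret N: right_module R N by fact
  fix f assume f: "f \<in> rmod_hom R (prod_rmod P Q) N"
  obtain h where h: "h \<in> rmod_hom R P M" "\<And>x. x \<in> carrier P \<Longrightarrow> g (h x) = f (x, \<zero>\<^bsub>Q\<^esub>)"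
    using lP rmod_hom_comp[OF inl_hom[OF Q] f] unfolding lifts_def by meson
  obtain k where k: "k \<in> rmod_hom R Q M" "\<And>y. y \<in> carrier Q \<Longrightarrow> g (k y) = f (\<zero>\<^bsub>P\<^esub>, y)"
    using lQ rmod_hom_comp[OF inr_hom[OF P] f] unfolding lifts_def by meson
  have hk: "(\<lambda>x. h (fst x) \<oplus>\<^bsub>M\<^esub> k (snd x)) \<in> rmod_hom R (prod_rmod P Q) M"
    by (intro rmod_hom_plus[OF M] rmod_hom_comp[OF fst_hom] rmod_hom_comp[OF snd_hom] h k)
  have "g (h (fst x) \<oplus>\<^bsub>M\<^esub> k (snd x)) = f x" if x: "x \<in> carrier (prod_rmod P Q)" for x
  proof -
    have "g (h (fst x) \<oplus>\<^bsub>M\<^esub> k (snd x)) = f (fst x, \<zero>\<^bsub>Q\<^esub>) \<oplus>\<^bsub>N\<^esub> f (\<zero>\<^bsub>P\<^esub>, snd x)"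
      using x by (simp add: rmod_hom_add[OF g] rmod_hom_closed[OF h(1)] rmod_hom_closed[OF k(1)] h k)
    also have "\<dots> = f x"
      using x by (subst rmod_hom_add[OF f, symmetric]) auto
    finally show ?thesis .
  qed
  then show "\<exists>h\<in>rmod_hom R (prod_rmod P Q) M. \<forall>x\<in>carrier (prod_rmod P Q). g (h x) = f x"
    using hk by (intro bexI[of _ "\<lambda>x. h (fst x) \<oplus>\<^bsub>M\<^esub> k (snd x)"]) auto
qed

lemma lifts_retract:
  assumes i: "i \<in> rmod_hom R P H" and r: "r \<in> rmod_hom R H P"
    and ri: "\<And>x. x \<in> carrier P \<Longrightarrow> r (i x) = x" and l: "lifts R H M N g"
  shows "lifts R P M N g"
  unfolding lifts_def
proof
  fix f assume f: "f \<in> rmod_hom R P N"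
  obtain h where h: "h \<in> rmod_hom R H M" "\<And>x. x \<in> carrier H \<Longrightarrow> g (h x) = f (r x)"
    using l rmod_hom_comp[OF r f] unfolding lifts_def by meson
  have "g (h (i x)) = f x" if "x \<in> carrier P" for x
    using that h(2) ri rmod_hom_closed[OF i] by simp
  then show "\<exists>h\<in>rmod_hom R P M. \<forall>x\<in>carrier P. g (h x) = f x"
    using rmod_hom_comp[OF i h(1)] by (intro bexI[of _ "\<lambda>x. h (i x)"]) auto
qed

section \<open>Submodules and transport of structure\<close>

lemma submodule_right_module:
  assumes M: "right_module R M" and S: "S \<subseteq> carrier M" "\<zero>\<^bsub>M\<^esub> \<in> S"
    and add: "\<And>x y. \<lbrakk>x \<in> S; y \<in> S\<rbrakk> \<Longrightarrow> x \<oplus>\<^bsub>M\<^esub> y \<in> S"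
    and ract: "\<And>x a. \<lbrakk>x \<in> S; a \<in> carrier R\<rbrakk> \<Longrightarrow> x \<bullet>\<^bsub>M\<^esub> a \<in> S"
  shows "right_module R (M\<lparr>carrier := S\<rparr>)"
proof -
  interpret right_module R M by fact
  have c: "x \<in> carrier M" if "x \<in> S" for x using that S by auto
  have "abelian_group (M\<lparr>carrier := S\<rparr>)"
  proof (rule abelian_groupI)
    fix x assume "x \<in> carrier (M\<lparr>carrier := S\<rparr>)"
    then have x: "x \<in> S" by simp
    \<comment> \<open>Negatives are supplied by the action of the ring element -1.\<close>
    have "x \<bullet>\<^bsub>M\<^esub> (\<ominus>\<^bsub>R\<^esub> \<one>\<^bsub>R\<^esub>) \<oplus>\<^bsub>M\<^esub> x = x \<bullet>\<^bsub>M\<^esub> (\<ominus>\<^bsub>R\<^esub> \<one>\<^bsub>R\<^esub> \<oplus>\<^bsub>R\<^esub> \<one>\<^bsub>R\<^esub>)"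
      using c[OF x] by (simp add: ract_r_distr)
    also have "\<dots> = \<zero>\<^bsub>M\<^esub>" using c[OF x] by (simp add: R.l_neg)
    finally show "\<exists>y\<in>carrier (M\<lparr>carrier := S\<rparr>). y \<oplus>\<^bsub>M\<lparr>carrier := S\<rparr>\<^esub> x = \<zero>\<^bsub>M\<lparr>carrier := S\<rparr>\<^esub>"
      using ract[OF x, of "\<ominus>\<^bsub>R\<^esub> \<one>\<^bsub>R\<^esub>"] by auto
  qed (use S add c in \<open>auto simp: M.a_ac\<close>)
  then show ?thesis
    by (intro right_module.intro right_module_axioms.intro R.ring_axioms)
       (use ract c in \<open>auto simp: ract_l_distr ract_r_distr ract_assoc\<close>)
qed

definition transport_rmod :: "('m \<Rightarrow> 'n) \<Rightarrow> ('r, 'm) rmodule \<Rightarrow> ('r, 'n) rmodule" where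
  "transport_rmod e M = (let d = inv_into (carrier M) e in
     \<lparr>carrier = e ` carrier M, mult = undefined, one = undefined, zero = e \<zero>\<^bsub>M\<^esub>,
      add = (\<lambda>u v. e (d u \<oplus>\<^bsub>M\<^esub> d v)), ract = (\<lambda>u a. e (d u \<bullet>\<^bsub>M\<^esub> a))\<rparr>)"

lemma transport_rmod:
  assumes M: "right_module R M" and e: "inj_on e (carrier M)"
  shows "right_module R (transport_rmod e M)"
    and "e \<in> rmod_hom R M (transport_rmod e M)"
    and "inv_into (carrier M) e \<in> rmod_hom R (transport_rmod e M) M"
proof -
  interpret right_module R M by fact
  let ?T = "transport_rmod e M"
  have sel: "carrier ?T = e ` carrier M" "\<zero>\<^bsub>?T\<^esub> = e \<zero>\<^bsub>M\<^esub>"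
    "\<And>x y. \<lbrakk>x \<in> carrier M; y \<in> carrier M\<rbrakk> \<Longrightarrow> e x \<oplus>\<^bsub>?T\<^esub> e y = e (x \<oplus>\<^bsub>M\<^esub> y)"
    "\<And>x a. x \<in> carrier M \<Longrightarrow> e x \<bullet>\<^bsub>?T\<^esub> a = e (x \<bullet>\<^bsub>M\<^esub> a)"
    by (simp_all add: transport_rmod_def Let_def inv_into_f_f[OF e])
  have "abelian_group ?T"
  proof (rule abelian_groupI)
    fix u assume "u \<in> carrier ?T"
    then obtain x where x: "x \<in> carrier M" "u = e x" by (auto simp: sel)
    then have "e (\<ominus>\<^bsub>M\<^esub> x) \<oplus>\<^bsub>?T\<^esub> u = \<zero>\<^bsub>?T\<^esub>" by (simp add: sel M.l_neg)
    then show "\<exists>v\<in>carrier ?T. v \<oplus>\<^bsub>?T\<^esub> u = \<zero>\<^bsub>?T\<^esub>"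
      using x by (intro bexI[of _ "e (\<ominus>\<^bsub>M\<^esub> x)"]) (auto simp: sel(1))
  qed (auto simp: sel M.a_ac)
  then show "right_module R ?T"
    by (intro right_module.intro right_module_axioms.intro R.ring_axioms)
       (auto simp: sel ract_l_distr ract_r_distr ract_assoc)
  show "e \<in> rmod_hom R M ?T" by (intro rmod_homI) (auto simp: sel)
  show "inv_into (carrier M) e \<in> rmod_hom R ?T M"
    by (intro rmod_homI) (auto simp: sel inv_into_f_f[OF e])
qed

section \<open>Modules over a quotient ring\<close>

text \<open>Restriction of scalars along R -> R/I. It lets maps from R-modules to R/I-modules be
  treated as ordinary R-homomorphisms.\<close>

definition restrict_rmod ::
    "('r, 'x) ring_scheme \<Rightarrow> 'r set \<Rightarrow> ('r set, 'n) rmodule \<Rightarrow> ('r, 'n) rmodule" where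
  "restrict_rmod R I N = \<lparr>carrier = carrier N, mult = undefined, one = undefined,
     zero = \<zero>\<^bsub>N\<^esub>, add = add N, ract = (\<lambda>x a. x \<bullet>\<^bsub>N\<^esub> (I +>\<^bsub>R\<^esub> a))\<rparr>"

lemma restrict_rmod_sel [simp]:
  "carrier (restrict_rmod R I N) = carrier N" "\<zero>\<^bsub>restrict_rmod R I N\<^esub> = \<zero>\<^bsub>N\<^esub>"
  "add (restrict_rmod R I N) = add N"
  "x \<bullet>\<^bsub>restrict_rmod R I N\<^esub> a = x \<bullet>\<^bsub>N\<^esub> (I +>\<^bsub>R\<^esub> a)"
  by (simp_all add: restrict_rmod_def)

context ideal
begin

lemma rcos_closed: "a \<in> carrier R \<Longrightarrow> I +> a \<in> carrier (R Quot I)"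
  using rcos_ring_hom by (rule ring_hom_closed)

lemma rcos_add: "\<lbrakk>a \<in> carrier R; b \<in> carrier R\<rbrakk> \<Longrightarrow>
    I +> (a \<oplus> b) = (I +> a) \<oplus>\<^bsub>R Quot I\<^esub> (I +> b)"
  using rcos_ring_hom by (rule ring_hom_add)

lemma rcos_mult: "\<lbrakk>a \<in> carrier R; b \<in> carrier R\<rbrakk> \<Longrightarrow>
    I +> (a \<otimes> b) = (I +> a) \<otimes>\<^bsub>R Quot I\<^esub> (I +> b)"
  using rcos_ring_hom by (rule ring_hom_mult)

lemma rcos_one: "I +> \<one> = \<one>\<^bsub>R Quot I\<^esub>"
  using rcos_ring_hom by (rule ring_hom_one)

lemma rcos_surj: "(\<lambda>a. I +> a) ` carrier R = carrier (R Quot I)"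
  by (auto simp: FactRing_def A_RCOSETS_def' image_iff)

lemma rcos_eq_zero_iff: "a \<in> carrier R \<Longrightarrow> I +> a = \<zero>\<^bsub>R Quot I\<^esub> \<longleftrightarrow> a \<in> I"
  unfolding FactRing_def
  by simp (metis a_coset_join1 a_coset_join2 a_subset a_subgroup)

lemma restrict_rmod_right_module:
  assumes "right_module (R Quot I) N"
  shows "right_module R (restrict_rmod R I N)"
proof -
  interpret N: right_module "R Quot I" N by fact
  have "abelian_group (restrict_rmod R I N)"
    by (rule abelian_groupI) (auto simp: N.M.a_ac intro: N.M.l_neg bexI[of _ "\<ominus>\<^bsub>N\<^esub> _"])
  then show ?thesis
    by (intro right_module.intro right_module_axioms.intro ring_axioms)
       (auto simp: rcos_closed rcos_add rcos_mult rcos_one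
         N.ract_l_distr N.ract_r_distr N.ract_assoc)
qed

lemma restrict_rmod_hom:
  "f \<in> rmod_hom (R Quot I) M N \<Longrightarrow> f \<in> rmod_hom R (restrict_rmod R I M) (restrict_rmod R I N)"
  by (auto simp: rmod_hom_def rcos_closed)

lemma rcos_hom: "(\<lambda>a. I +> a) \<in> rmod_hom R (regular_rmod R) (restrict_rmod R I (regular_rmod (R Quot I)))"
  by (intro rmod_homI) (auto simp: rcos_closed rcos_add rcos_mult)

text \<open>I acts as zero on a module restricted from R/I, so every map into such a module factors
  through P / P I.\<close>

lemma hom_restrict_mult_ideal_zero:
  assumes P: "right_module R P" and N: "right_module (R Quot I) N"
    and p: "p \<in> rmod_hom R P (restrict_rmod R I N)" and x: "x \<in> rmod_mult_ideal P I"
  shows "p x = \<zero>\<^bsub>N\<^esub>"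
proof -
  interpret P: right_module R P by fact
  interpret N: right_module "R Quot I" N by fact
  have RN: "right_module R (restrict_rmod R I N)" by (rule restrict_rmod_right_module[OF N])
  interpret RN: right_module R "restrict_rmod R I N" by fact
  have "x \<in> {x \<in> carrier P. p x = \<zero>\<^bsub>N\<^esub>}"
    using P a_subset x
  proof (induction rule: mult_ideal_induct)
    case (gen x a)
    then have "a \<in> carrier R" using a_subset by auto
    moreover have "I +> a = \<zero>\<^bsub>R Quot I\<^esub>" using gen calculation rcos_eq_zero_iff by simp
    ultimately show ?case
      using gen rmod_hom_closed[OF p gen(1)] by (simp add: rmod_hom_ract[OF p])
  next
    case (a_inv x)
    have "p (\<ominus>\<^bsub>P\<^esub> x) = \<ominus>\<^bsub>restrict_rmod R I N\<^esub> \<zero>\<^bsub>restrict_rmod R I N\<^esub>"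
      using a_inv rmod_hom_a_inv[OF P RN p] by simp
    also have "\<dots> = \<zero>\<^bsub>restrict_rmod R I N\<^esub>"
      by (rule RN.M.minus_equality) auto
    finally show ?case using a_inv by simp
  qed (use rmod_hom_zero[OF P RN p] in \<open>auto simp: rmod_hom_add[OF p]\<close>)
  then show ?thesis by simp
qed

text \<open>First isomorphism theorem for \<open>p\<close>, whose kernel is exactly P I: one
  inclusion is \<open>ker\<close>, the other holds because I kills N.\<close>

lemma quot_rmod_iso:
  assumes P: "right_module R P" and N: "right_module (R Quot I) N"
    and p: "p \<in> rmod_hom R P (restrict_rmod R I N)" and surj: "p ` carrier P = carrier N"
    and ker: "\<And>x. \<lbrakk>x \<in> carrier P; p x = \<zero>\<^bsub>N\<^esub>\<rbrakk> \<Longrightarrow> x \<in> rmod_mult_ideal P I"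
  shows "rmod_iso (R Quot I) (quot_rmod P I) N"
proof -
  interpret P: right_module R P by fact
  interpret N: right_module "R Quot I" N by fact
  define K where "K = rmod_mult_ideal P I"
  have RN: "right_module R (restrict_rmod R I N)" by (rule restrict_rmod_right_module[OF N])
  interpret RN: right_module R "restrict_rmod R I N" by fact
  interpret K: abelian_subgroup K P
    using mult_ideal_subgroup[OF P a_subset]
    by (intro abelian_subgroupI3 additive_subgroup.intro P.M.abelian_group_axioms) (simp add: K_def)
  have sel: "carrier (quot_rmod P I) = a_rcosets\<^bsub>P\<^esub> K" "add (quot_rmod P I) = set_add P"
    "\<And>X A. X \<bullet>\<^bsub>quot_rmod P I\<^esub> A = (\<Union>x\<in>X. \<Union>a\<in>A. K +>\<^bsub>P\<^esub> (x \<bullet>\<^bsub>P\<^esub> a))"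
    by (simp_all add: quot_rmod_def Let_def K_def)
  have carr: "\<exists>x\<in>carrier P. X = K +>\<^bsub>P\<^esub> x" if "X \<in> carrier (quot_rmod P I)" for X
    using that by (auto simp: sel A_RCOSETS_def')
  have pc: "p x \<in> carrier N" if "x \<in> carrier P" for x
    using rmod_hom_closed[OF p that] by simp
  have coset: "y \<in> carrier P \<and> p y = p x" if x: "x \<in> carrier P" and y: "y \<in> K +>\<^bsub>P\<^esub> x" for x y
  proof -
    obtain n where n: "n \<in> K" "y = n \<oplus>\<^bsub>P\<^esub> x" using y by (auto simp: a_r_coset_def')
    have "p n = \<zero>\<^bsub>N\<^esub>" "n \<in> carrier P"
      using n hom_restrict_mult_ideal_zero[OF P N p] K.a_subset by (auto simp: K_def)
    then show ?thesis using x n pc by (simp add: rmod_hom_add[OF p])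
  qed
  \<comment> \<open>The choice is harmless, because \<open>p\<close> is constant on each coset of P
    I.\<close>
  define f where "f X = p (SOME x. x \<in> X)" for X
  have f: "f X = p x" if "u \<in> X" "\<And>u. u \<in> X \<Longrightarrow> p u = p x" for X x u
    unfolding f_def by (rule that(2)) (rule someI, rule that(1))
  have fcos: "f (K +>\<^bsub>P\<^esub> x) = p x" if "x \<in> carrier P" for x
    by (rule f[OF K.a_rcos_self[OF that]]) (use coset[OF that] in blast)
  show ?thesis
    unfolding rmod_iso_def
  proof (intro bexI[of _ f])
    show "f \<in> rmod_hom (R Quot I) (quot_rmod P I) N"
    proof (rule rmod_homI)
      fix X assume "X \<in> carrier (quot_rmod P I)"
      then obtain x where x: "x \<in> carrier P" "X = K +>\<^bsub>P\<^esub> x" using carr by blast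
      show "f X \<in> carrier N" using x fcos pc by simp
      {
        fix Y assume "Y \<in> carrier (quot_rmod P I)"
        then obtain y where y: "y \<in> carrier P" "Y = K +>\<^bsub>P\<^esub> y" using carr by blast
        have "X \<oplus>\<^bsub>quot_rmod P I\<^esub> Y = K +>\<^bsub>P\<^esub> (x \<oplus>\<^bsub>P\<^esub> y)"
          using x y K.a_rcos_sum by (simp add: sel)
        then show "f (X \<oplus>\<^bsub>quot_rmod P I\<^esub> Y) = f X \<oplus>\<^bsub>N\<^esub> f Y"
          using x y fcos by (simp add: rmod_hom_add[OF p])
      }
      fix A assume "A \<in> carrier (R Quot I)"
      then obtain a where a: "a \<in> carrier R" "A = I +> a" using rcos_surj by auto
      \<comment> \<open>The product of cosets is a union over all representatives. It is enough that
        it contains x a and that \<open>p\<close> takes a single value on it.\<close>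
      have "f (X \<bullet>\<^bsub>quot_rmod P I\<^esub> A) = p (x \<bullet>\<^bsub>P\<^esub> a)"
      proof (rule f)
        show "x \<bullet>\<^bsub>P\<^esub> a \<in> X \<bullet>\<^bsub>quot_rmod P I\<^esub> A"
          unfolding sel using x a
          by (intro UN_I[of x] UN_I[of a]) (auto intro: K.a_rcos_self a_rcos_self)
        fix u assume "u \<in> X \<bullet>\<^bsub>quot_rmod P I\<^esub> A"
        then obtain y b where yb: "y \<in> X" "b \<in> A" "u \<in> K +>\<^bsub>P\<^esub> (y \<bullet>\<^bsub>P\<^esub> b)" by (auto simp: sel)
        have y: "y \<in> carrier P" "p y = p x" using coset x yb by auto
        have b: "b \<in> carrier R" "I +> b = I +> a"
          using yb a a_repr_independence' a_elemrcos_carrier by auto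
        have "p u = p (y \<bullet>\<^bsub>P\<^esub> b)" using coset yb y b by simp
        then show "p u = p (x \<bullet>\<^bsub>P\<^esub> a)"
          using x y a b by (simp add: rmod_hom_ract[OF p])
      qed
      then show "f (X \<bullet>\<^bsub>quot_rmod P I\<^esub> A) = f X \<bullet>\<^bsub>N\<^esub> A"
        using x a fcos by (simp add: rmod_hom_ract[OF p])
    qed
    show "bij_betw f (carrier (quot_rmod P I)) (carrier N)"
    proof (rule bij_betwI')
      fix X Y assume X: "X \<in> carrier (quot_rmod P I)" and Y: "Y \<in> carrier (quot_rmod P I)"
      obtain x where x: "x \<in> carrier P" "X = K +>\<^bsub>P\<^esub> x" using carr[OF X] by blast
      obtain y where y: "y \<in> carrier P" "Y = K +>\<^bsub>P\<^esub> y" using carr[OF Y] by blast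
      show "f X = f Y \<longleftrightarrow> X = Y"
      proof
        assume "f X = f Y"
        then have "p x = p y" using x y fcos by simp
        then have "p (x \<ominus>\<^bsub>P\<^esub> y) = \<zero>\<^bsub>restrict_rmod R I N\<^esub>"
          using x y rmod_hom_closed[OF p]
            by (simp add: rmod_hom_diff[OF P RN p] a_minus_def[of "restrict_rmod R I N"]
              RN.M.r_neg[simplified])
        then have "x \<ominus>\<^bsub>P\<^esub> y \<in> K" using ker x y by (simp add: K_def)
        moreover have "x = (x \<ominus>\<^bsub>P\<^esub> y) \<oplus>\<^bsub>P\<^esub> y"
          using x y by (simp add: a_minus_def P.M.a_assoc P.M.l_neg)
        ultimately have "x \<in> K +>\<^bsub>P\<^esub> y" by (auto simp: a_r_coset_def')
        then show "X = Y"
          using K.a_repr_independence' x y by metis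
      qed simp
      show "f X \<in> carrier N" using x fcos pc by simp
    next
      fix z assume "z \<in> carrier N"
      then obtain x where "x \<in> carrier P" "z = p x" using surj by auto
      then show "\<exists>X\<in>carrier (quot_rmod P I). z = f X"
        using fcos by (intro bexI[of _ "K +>\<^bsub>P\<^esub> x"]) (auto simp: sel A_RCOSETS_def')
    qed
  qed
qed

text \<open>A map P -> R, reduced modulo I, kills P I and hence induces a map N -> R/I. Conversely
  the lifting hypothesis makes every map N -> R/I arise in this way. So the generators of the two
  traces correspond under reduction.\<close>

lemma trace_image:
  assumes P: "right_module R P" and N: "right_module (R Quot I) N"
    and p: "p \<in> rmod_hom R P (restrict_rmod R I N)" and surj: "p ` carrier P = carrier N"
    and ker: "\<And>x. \<lbrakk>x \<in> carrier P; p x = \<zero>\<^bsub>N\<^esub>\<rbrakk> \<Longrightarrow> x \<in> rmod_mult_ideal P I"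
    and lift: "lifts R P (regular_rmod R) (restrict_rmod R I (regular_rmod (R Quot I))) (\<lambda>a. I +> a)"
  shows "(\<lambda>t. I +> t) ` rmod_trace R P = rmod_trace (R Quot I) N"
proof -
  let ?r = "\<lambda>a. I +> a" and ?S = "restrict_rmod R I (regular_rmod (R Quot I))"
  let ?A = "\<Union>f\<in>rmod_hom R P (regular_rmod R). f ` carrier P"
  let ?B = "\<Union>f\<in>rmod_hom (R Quot I) N (regular_rmod (R Quot I)). f ` carrier N"
  interpret P: right_module R P by fact
  interpret N: right_module "R Quot I" N by fact
  have RN: "right_module R (restrict_rmod R I N)" by (rule restrict_rmod_right_module[OF N])
  interpret RN: right_module R "restrict_rmod R I N" by fact
  have S: "right_module R ?S"
    by (intro restrict_rmod_right_module regular_rmod_right_module quotient_is_ring)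
  interpret q: ring_hom_ring R "R Quot I" ?r by (rule rcos_ring_hom_ring)
  interpret h: group_hom "add_monoid R" "add_monoid (R Quot I)" ?r by (rule q.a_group_hom)
  have A: "?A \<subseteq> carrier R" by (auto simp: rmod_hom_def)
  have "?r ` ?A = ?B"
  proof (intro equalityI subsetI)
    fix t assume "t \<in> ?r ` ?A"
    then obtain f x where f: "f \<in> rmod_hom R P (regular_rmod R)" and x: "x \<in> carrier P"
      and t: "t = I +> f x" by auto
    have rf: "(\<lambda>x. I +> f x) \<in> rmod_hom R P ?S"
      by (rule rmod_hom_comp[OF f rcos_hom])
    \<comment> \<open>The reduction of \<open>f\<close> factors through \<open>p\<close>: if p x = p
      y then x - y lies in P I, on which the reduction vanishes.\<close>
    have wd: "I +> f x = I +> f y" if "x \<in> carrier P" "y \<in> carrier P" "p x = p y" for x y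
    proof -
      have "p (x \<ominus>\<^bsub>P\<^esub> y) = \<zero>\<^bsub>restrict_rmod R I N\<^esub>"
        using that rmod_hom_closed[OF p]
            by (simp add: rmod_hom_diff[OF P RN p] a_minus_def[of "restrict_rmod R I N"]
              RN.M.r_neg[simplified])
      then have "x \<ominus>\<^bsub>P\<^esub> y \<in> rmod_mult_ideal P I" using ker that by simp
      then have "I +> f (x \<ominus>\<^bsub>P\<^esub> y) = \<zero>\<^bsub>regular_rmod (R Quot I)\<^esub>"
        by (rule hom_restrict_mult_ideal_zero[OF P regular_rmod_right_module[OF quotient_is_ring] rf])
      moreover have "I +> f x = (I +> f (x \<ominus>\<^bsub>P\<^esub> y)) \<oplus>\<^bsub>?S\<^esub> (I +> f y)"
        using that rmod_hom_add[OF rf, of "x \<ominus>\<^bsub>P\<^esub> y" y]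
        by (simp add: P.M.a_assoc P.M.l_neg a_minus_def)
      ultimately show ?thesis
        using rmod_hom_closed[OF rf that(2)] N.R.l_zero by simp
    qed
    define f' where "f' y = I +> f (inv_into (carrier P) p y)" for y
    have f': "f' (p x) = I +> f x" if "x \<in> carrier P" for x
      unfolding f'_def using that
      by (intro wd) (auto simp: inv_into_into f_inv_into_f)
    have "f' \<in> rmod_hom (R Quot I) N (regular_rmod (R Quot I))"
    proof (rule rmod_homI)
      fix y assume "y \<in> carrier N"
      then obtain x where x: "x \<in> carrier P" "y = p x" using surj by auto
      show "f' y \<in> carrier (regular_rmod (R Quot I))"
        using x f' rmod_hom_closed[OF rf] by simp
      {
        fix z assume "z \<in> carrier N"
        then obtain w where w: "w \<in> carrier P" "z = p w" using surj by auto
        have "y \<oplus>\<^bsub>N\<^esub> z = p (x \<oplus>\<^bsub>P\<^esub> w)" using x w by (simp add: rmod_hom_add[OF p])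
        then show "f' (y \<oplus>\<^bsub>N\<^esub> z) = f' y \<oplus>\<^bsub>regular_rmod (R Quot I)\<^esub> f' z"
          using x w f' rmod_hom_add[OF rf] by simp
      }
      fix A assume "A \<in> carrier (R Quot I)"
      then obtain a where a: "a \<in> carrier R" "A = I +> a" using rcos_surj by auto
      have "y \<bullet>\<^bsub>N\<^esub> A = p (x \<bullet>\<^bsub>P\<^esub> a)" using x a by (simp add: rmod_hom_ract[OF p])
      then show "f' (y \<bullet>\<^bsub>N\<^esub> A) = f' y \<bullet>\<^bsub>regular_rmod (R Quot I)\<^esub> A"
        using x a f' rmod_hom_ract[OF rf] by simp
    qed
    moreover have "t = f' (p x)" "p x \<in> carrier N" using f' x t surj by auto
    ultimately show "t \<in> ?B" by blast
  next
    fix t assume "t \<in> ?B"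
    then obtain f y where f: "f \<in> rmod_hom (R Quot I) N (regular_rmod (R Quot I))"
      and y: "y \<in> carrier N" "t = f y" by auto
    obtain x where x: "x \<in> carrier P" "y = p x" using y surj by auto
    have "(\<lambda>x. f (p x)) \<in> rmod_hom R P ?S"
      by (rule rmod_hom_comp[OF p restrict_rmod_hom[OF f]])
    then obtain g where "g \<in> rmod_hom R P (regular_rmod R)"
      "\<And>x. x \<in> carrier P \<Longrightarrow> I +> g x = f (p x)"
      using lift unfolding lifts_def by meson
    then show "t \<in> ?r ` ?A" using x y by auto
  qed
  \<comment> \<open>Reduction is a group homomorphism, so the image of the subgroup generated by
    \<open>?A\<close> is generated by the image of \<open>?A\<close>.\<close>
  then show ?thesis
    unfolding rmod_trace_def using h.generate_img[of ?A] A by simp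
qed

end

text \<open>A map f from Q to R extends to P as f o r and keeps all its values.\<close>

lemma trace_retract:
  assumes "ring R" and i: "i \<in> rmod_hom R Q P" and r: "r \<in> rmod_hom R P Q"
    and ri: "\<And>x. x \<in> carrier Q \<Longrightarrow> r (i x) = x"
  shows "rmod_trace R Q \<subseteq> rmod_trace R P"
  unfolding rmod_trace_def
proof (rule group.mono_generate)
  interpret ring R by fact
  show "group (add_monoid R)" by (rule add.is_group)
  show "(\<Union>f\<in>rmod_hom R Q (regular_rmod R). f ` carrier Q)
      \<subseteq> (\<Union>f\<in>rmod_hom R P (regular_rmod R). f ` carrier P)"
  proof
    fix t assume "t \<in> (\<Union>f\<in>rmod_hom R Q (regular_rmod R). f ` carrier Q)"
    then obtain f x where f: "f \<in> rmod_hom R Q (regular_rmod R)" and x: "x \<in> carrier Q" "t = f x"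
      by auto
    have "t = f (r (i x))" "i x \<in> carrier P" using x ri rmod_hom_closed[OF i] by auto
    then show "t \<in> (\<Union>f\<in>rmod_hom R P (regular_rmod R). f ` carrier P)"
      using rmod_hom_comp[OF r f] by (intro UN_I[of "\<lambda>x. f (r x)"]) auto
  qed
qed

section \<open>Free covers and traces\<close>

text \<open>Since the free module has the whole type of \<open>N\<close> as its basis, basis
  elements outside \<open>carrier N\<close> are sent to zero.\<close>

definition cover :: "('r, 'x) ring_scheme \<Rightarrow> ('r, 'n) rmodule \<Rightarrow> ('n \<Rightarrow> 'r) \<Rightarrow> 'n" where
  "cover R N = fin_eval (regular_rmod R) N
     (\<lambda>y a. (if y \<in> carrier N then y else \<zero>\<^bsub>N\<^esub>) \<bullet>\<^bsub>N\<^esub> a)"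

lemma cover:
  fixes R :: "('r, 'x) ring_scheme" and N :: "('r, 'n) rmodule"
  assumes N: "right_module R N"
  shows cover_hom: "cover R N \<in> rmod_hom R (fin_rmod (regular_rmod R)) N"
    and cover_surj: "cover R N ` carrier (fin_rmod (regular_rmod R)) = carrier N"
proof -
  interpret right_module R N by fact
  let ?G = "regular_rmod R"
  have G: "right_module R ?G" by (rule regular_rmod_right_module[OF R.ring_axioms])
  have h: "(\<lambda>a. (if y \<in> carrier N then y else \<zero>\<^bsub>N\<^esub>) \<bullet>\<^bsub>N\<^esub> a) \<in> rmod_hom R ?G N" for y
    by (intro ract_hom_regular[OF N]) auto
  show hom: "cover R N \<in> rmod_hom R (fin_rmod ?G) N"
    unfolding cover_def by (rule fin_eval_hom[OF G N h])
  have "y = cover R N (single ?G y \<one>\<^bsub>R\<^esub>)" if "y \<in> carrier N" for y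
    unfolding cover_def using that by (simp add: fin_eval_single[OF G N h])
  moreover have "single ?G y \<one>\<^bsub>R\<^esub> \<in> carrier (fin_rmod ?G)" for y :: 'n
    by (rule rmod_hom_closed[OF single_hom[OF G]]) auto
  ultimately have "carrier N \<subseteq> cover R N ` carrier (fin_rmod ?G)"
    by (intro subsetI) (rule image_eqI)
  then show "cover R N ` carrier (fin_rmod ?G) = carrier N"
    using hom by (auto simp: rmod_hom_def)
qed

lemma projective_section:
  assumes P: "projective_rmod R P" and M: "right_module R M"
    and g: "g \<in> rmod_hom R M P" "g ` carrier M = carrier P"
  obtains s where "s \<in> rmod_hom R P M" "\<And>x. x \<in> carrier P \<Longrightarrow> g (s x) = x"
  using projective_rmod_lift[OF P M _ g rmod_hom_id] P
  unfolding projective_rmod_def by blast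

lemma regular_mult_ideal:
  assumes "ring R" "I \<subseteq> carrier R" "a \<in> I"
  shows "a \<in> rmod_mult_ideal (regular_rmod R) I"
proof -
  interpret ring R by fact
  have "\<one>\<^bsub>R\<^esub> \<bullet>\<^bsub>regular_rmod R\<^esub> a \<in> rmod_mult_ideal (regular_rmod R) I"
    using assms by (intro mult_ideal_incl) auto
  then show ?thesis using assms by auto
qed

lemma trace_incl:
  "\<lbrakk>f \<in> rmod_hom R P (regular_rmod R); x \<in> carrier P\<rbrakk> \<Longrightarrow> f x \<in> rmod_trace R P"
  unfolding rmod_trace_def by (rule generate.incl) auto

lemma trace_subset: "ring R \<Longrightarrow> rmod_trace R P \<subseteq> carrier R"
proof -
  assume "ring R"
  then interpret ring R .
  show ?thesis
    unfolding rmod_trace_def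
    by (rule add.generate_incl[simplified]) (auto simp: rmod_hom_def)
qed

text \<open>Dual basis argument: for a section s of the free cover, the coordinates of s x are
  values of homomorphisms Q -> R and so lie in the trace. Mapping s x back to x exhibits x in Q
  Tr(Q).\<close>

lemma projective_mult_trace:
  assumes Q: "projective_rmod R Q" and x: "x \<in> carrier Q"
  shows "x \<in> rmod_mult_ideal Q (rmod_trace R Q)"
proof -
  let ?F = "fin_rmod (regular_rmod R) :: ('a, 'c \<Rightarrow> 'a) rmodule"
  have QM: "right_module R Q" using Q by (simp add: projective_rmod_def)
  interpret right_module R Q by fact
  note R = R.ring_axioms
  note G = regular_rmod_right_module[OF R]
  have F: "right_module R ?F" by (rule fin_rmod_right_module[OF G])
  obtain s where s: "s \<in> rmod_hom R Q ?F" "\<And>x. x \<in> carrier Q \<Longrightarrow> cover R Q (s x) = x"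
    using projective_section[OF Q F cover_hom[OF QM] cover_surj[OF QM]] by blast
  have "s x i \<in> rmod_trace R Q" for i
    using trace_incl[OF rmod_hom_comp[OF s(1) proj_hom] x] .
  then have "s x \<in> rmod_mult_ideal ?F (rmod_trace R Q)"
    using rmod_hom_closed[OF s(1) x] trace_subset[OF R, of Q]
    by (intro fin_rmod_mult_ideal[OF G] regular_mult_ideal[OF R])
  then have "cover R Q (s x) \<in> rmod_mult_ideal Q (rmod_trace R Q)"
    by (rule rmod_hom_mult_ideal[OF F QM cover_hom[OF QM] trace_subset[OF R]])
  then show ?thesis using s(2) x by simp
qed

text \<open>The sum of the images of all homomorphisms from Q to M. Terms are added one at a time,
  so that an induction can allot one copy of Q to each term.\<close>

inductive_set hom_sums ::
    "('r, 'x) ring_scheme \<Rightarrow> ('r, 'q) rmodule \<Rightarrow> ('r, 'm) rmodule \<Rightarrow> 'm set"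
  for R Q M where
  zero: "\<zero>\<^bsub>M\<^esub> \<in> hom_sums R Q M"
| add: "\<lbrakk>h \<in> rmod_hom R Q M; x \<in> carrier Q; w \<in> hom_sums R Q M\<rbrakk> \<Longrightarrow> h x \<oplus>\<^bsub>M\<^esub> w \<in> hom_sums R Q M"

context
  fixes R :: "('r, 'x) ring_scheme" and Q :: "('r, 'q) rmodule" and M :: "('r, 'm) rmodule"
  assumes Q: "right_module R Q" and M: "right_module R M"
begin

interpretation Q: right_module R Q by (rule Q)
interpretation M: right_module R M by (rule M)

lemma hom_sums_carrier: "w \<in> hom_sums R Q M \<Longrightarrow> w \<in> carrier M"
  by (induction rule: hom_sums.induct) (auto simp: rmod_hom_closed)

lemma hom_sums_add:
  "\<lbrakk>v \<in> hom_sums R Q M; w \<in> hom_sums R Q M\<rbrakk> \<Longrightarrow> v \<oplus>\<^bsub>M\<^esub> w \<in> hom_sums R Q M"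
proof (induction rule: hom_sums.induct)
  case (add h x v)
  then show ?case
    using hom_sums.add[OF add.hyps(1,2), of "v \<oplus>\<^bsub>M\<^esub> w"]
    by (simp add: rmod_hom_closed hom_sums_carrier M.M.a_assoc)
qed (simp add: hom_sums_carrier)

lemma hom_sums_incl: "\<lbrakk>h \<in> rmod_hom R Q M; x \<in> carrier Q\<rbrakk> \<Longrightarrow> h x \<in> hom_sums R Q M"
  using hom_sums.add[OF _ _ hom_sums.zero, of h R Q M x] by (simp add: rmod_hom_closed)

lemma hom_sums_a_inv: "w \<in> hom_sums R Q M \<Longrightarrow> \<ominus>\<^bsub>M\<^esub> w \<in> hom_sums R Q M"
proof (induction rule: hom_sums.induct)
  case zero
  have "\<ominus>\<^bsub>M\<^esub> \<zero>\<^bsub>M\<^esub> = \<zero>\<^bsub>M\<^esub>" by (rule M.M.minus_equality) auto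
  then show ?case by (metis hom_sums.zero)
next
  case (add h x w)
  then show ?case
    using hom_sums.add[OF add.hyps(1), of "\<ominus>\<^bsub>Q\<^esub> x" "\<ominus>\<^bsub>M\<^esub> w"]
    by (simp add: rmod_hom_a_inv[OF Q M] M.M.minus_add rmod_hom_closed hom_sums_carrier)
qed

text \<open>For f : Q -> R the element x f(y) is the value at y of the homomorphism y |-> x f(y)
  from Q to M.\<close>

lemma ract_trace_hom_sums:
  assumes x: "x \<in> carrier M" and a: "a \<in> rmod_trace R Q"
  shows "x \<bullet>\<^bsub>M\<^esub> a \<in> hom_sums R Q M"
proof -
  let ?S = "{a \<in> carrier R. x \<bullet>\<^bsub>M\<^esub> a \<in> hom_sums R Q M}"
  have neg: "x \<bullet>\<^bsub>M\<^esub> (\<ominus>\<^bsub>R\<^esub> a) = \<ominus>\<^bsub>M\<^esub> (x \<bullet>\<^bsub>M\<^esub> a)" if "a \<in> carrier R" for a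
    using rmod_hom_a_inv[OF regular_rmod_right_module[OF Q.R.ring_axioms] M ract_hom_regular[OF M x]] that x
    by (intro M.M.minus_equality[symmetric]) (auto simp: M.ract_r_distr[symmetric] Q.R.l_neg)
  have "subgroup ?S (add_monoid R)"
    using x
    by (intro Q.R.add.subgroupI)
       (auto simp: neg a_inv_def[symmetric] M.ract_r_distr hom_sums.zero
         hom_sums_add hom_sums_a_inv intro: exI[of _ "\<zero>\<^bsub>R\<^esub>"])
  moreover have "f y \<in> ?S" if f: "f \<in> rmod_hom R Q (regular_rmod R)" and y: "y \<in> carrier Q" for f y
    using hom_sums_incl[OF rmod_hom_comp[OF f ract_hom_regular[OF M x]] y] rmod_hom_closed[OF f y]
    by simp
  ultimately have "rmod_trace R Q \<subseteq> ?S"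
    unfolding rmod_trace_def by (intro Q.R.add.generate_subgroup_incl) auto
  then show ?thesis using a by auto
qed

lemma mult_trace_hom_sums:
  assumes "w \<in> rmod_mult_ideal M (rmod_trace R Q)"
  shows "w \<in> hom_sums R Q M"
  using M trace_subset[OF Q.R.ring_axioms] assms
  by (induction rule: mult_ideal_induct)
     (auto simp: hom_sums_carrier hom_sums.zero hom_sums_add hom_sums_a_inv ract_trace_hom_sums)

text \<open>Each term of the sum gets its own copy of Q. Slot 0 is reserved for the zero map, and
  this is the copy of Q on which \<pi> will vanish.\<close>

lemma hom_sums_fin_eval:
  assumes "w \<in> hom_sums R Q M"
  shows "\<exists>h::nat \<Rightarrow> 'q \<Rightarrow> 'm. (\<forall>i. h i \<in> rmod_hom R Q M) \<and> h 0 = (\<lambda>_. \<zero>\<^bsub>M\<^esub>) \<and>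
    (\<exists>l\<in>carrier (fin_rmod Q). fin_eval Q M h l = w)"
proof -
  let ?L = "fin_rmod Q :: ('r, nat \<Rightarrow> 'q) rmodule"
  interpret L: right_module R ?L by (rule fin_rmod_right_module[OF Q])
  \<comment> \<open>The bound \<open>n\<close> names a slot at which \<open>l\<close> still
    vanishes, hence free for the next term; \<open>0 < n\<close> protects the reserved slot
    0.\<close>
  have "\<exists>(h::nat \<Rightarrow> 'q \<Rightarrow> 'm) l n. (\<forall>i. h i \<in> rmod_hom R Q M) \<and> h 0 = (\<lambda>_. \<zero>\<^bsub>M\<^esub>) \<and>
      l \<in> carrier ?L \<and> (\<forall>i\<ge>n. l i = \<zero>\<^bsub>Q\<^esub>) \<and> 0 < n \<and> fin_eval Q M h l = w"
    using assms
  proof (induction rule: hom_sums.induct)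
    case zero
    have h: "(\<lambda>_. \<zero>\<^bsub>M\<^esub>) \<in> rmod_hom R Q M" by (rule rmod_hom_const_zero[OF M])
    have "fin_eval Q M (\<lambda>_ _. \<zero>\<^bsub>M\<^esub>) (\<zero>\<^bsub>?L\<^esub> :: nat \<Rightarrow> 'q) = \<zero>\<^bsub>M\<^esub>"
      by (simp add: fin_eval_def)
    then show ?case
      using h by (intro exI[of _ "\<lambda>_ _. \<zero>\<^bsub>M\<^esub>"] exI[of _ "\<zero>\<^bsub>?L\<^esub>"] exI[of _ "Suc 0"])
        (use L.M.zero_closed in \<open>auto simp: fin_rmod_sel(2)\<close>)
  next
    case (add k x w)
    then obtain h l n where h: "\<And>i::nat. h i \<in> rmod_hom R Q M" "h 0 = (\<lambda>_. \<zero>\<^bsub>M\<^esub>)"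
      and l: "l \<in> carrier ?L" "\<And>i. n \<le> i \<Longrightarrow> l i = \<zero>\<^bsub>Q\<^esub>" and n: "0 < n"
      and w: "fin_eval Q M h l = w" by blast
    let ?h = "h(n := k)" and ?l = "single Q n x \<oplus>\<^bsub>?L\<^esub> l"
    have h': "?h i \<in> rmod_hom R Q M" for i using h add by simp
    have s: "single Q n x \<in> carrier ?L"
      by (rule rmod_hom_closed[OF single_hom[OF Q] add.hyps(2)])
    \<comment> \<open>The map in slot \<open>n\<close> may be replaced without effect on this value,
      since \<open>l\<close> vanishes there.\<close>
    have "fin_eval Q M ?h l = fin_eval Q M h l"
      unfolding fin_eval_def
      by (rule M.M.finsum_cong') (use l in \<open>auto simp: fin_rmod_sel rmod_hom_closed[OF h(1)]\<close>)
    then have "fin_eval Q M ?h ?l = k x \<oplus>\<^bsub>M\<^esub> w"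
      using rmod_hom_add[OF fin_eval_hom[where h = ?h, OF Q M h'] s l(1)] w add.hyps(2)
        fin_eval_single[where h = ?h, OF Q M h'] by simp
    moreover have "?l \<in> carrier ?L" using s l by simp
    moreover have "?l i = \<zero>\<^bsub>Q\<^esub>" if "Suc n \<le> i" for i
      using that l(2)[of i] by (simp add: fin_rmod_sel single_def)
    ultimately show ?case
      using h' h(2) n by (intro exI[of _ ?h] exI[of _ ?l] exI[of _ "Suc n"]) (auto simp: fun_upd_def)
  qed
  then show ?thesis by blast
qed

end

text \<open>The copies of \<open>Q\<close> with index \<open>0\<close> are not needed for the factorization.  Being killed by
  \<open>\<pi>\<close>, they survive as direct summands of the telescope and put \<open>Tr(Q)\<close> into its trace.\<close>

lemma factor_through_trace:
  fixes R :: "('r, 'x) ring_scheme" and Q :: "('r, 'q) rmodule" and M :: "('r, 'm) rmodule"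
    and \<delta> :: "('i \<Rightarrow> 'r) \<Rightarrow> 'm"
  assumes Q: "right_module R Q" and M: "right_module R M"
    and \<delta>: "\<delta> \<in> rmod_hom R (fin_rmod (regular_rmod R)) M"
    and img: "\<And>\<phi>. \<phi> \<in> carrier (fin_rmod (regular_rmod R)) \<Longrightarrow>
      \<delta> \<phi> \<in> rmod_mult_ideal M (rmod_trace R Q)"
  obtains \<beta> \<pi> where
    "\<beta> \<in> rmod_hom R (fin_rmod (regular_rmod R)) (fin_rmod (fin_rmod Q) :: ('r, 'i \<Rightarrow> nat \<Rightarrow> 'q) rmodule)"
    "\<pi> \<in> rmod_hom R (fin_rmod (fin_rmod Q) :: ('r, 'i \<Rightarrow> nat \<Rightarrow> 'q) rmodule) M"
    "\<And>\<phi>. \<phi> \<in> carrier (fin_rmod (regular_rmod R)) \<Longrightarrow> \<pi> (\<beta> \<phi>) = \<delta> \<phi>"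
    "\<And>y x. x \<in> carrier Q \<Longrightarrow> \<pi> (single (fin_rmod Q) y (single Q 0 x)) = \<zero>\<^bsub>M\<^esub>"
proof -
  let ?G = "regular_rmod R"
  let ?F = "fin_rmod ?G :: ('r, 'i \<Rightarrow> 'r) rmodule"
  let ?K = "fin_rmod Q :: ('r, nat \<Rightarrow> 'q) rmodule"
  let ?L = "fin_rmod ?K :: ('r, 'i \<Rightarrow> nat \<Rightarrow> 'q) rmodule"
  interpret Q: right_module R Q by fact
  interpret M: right_module R M by fact
  have G: "right_module R ?G" by (rule regular_rmod_right_module[OF Q.R.ring_axioms])
  have F: "right_module R ?F" by (rule fin_rmod_right_module[OF G])
  have K: "right_module R ?K" by (rule fin_rmod_right_module[OF Q])
  have L: "right_module R ?L" by (rule fin_rmod_right_module[OF K])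
  have e: "single ?G y \<one>\<^bsub>R\<^esub> \<in> carrier ?F" for y
    by (rule rmod_hom_closed[OF single_hom[OF G]]) auto
  \<comment> \<open>Freeness is used here: the defect is factored on one basis element at a time,
    and each basis element y receives its own family of copies of Q.\<close>
  have "\<exists>(h::nat \<Rightarrow> 'q \<Rightarrow> 'm) l. (\<forall>i. h i \<in> rmod_hom R Q M) \<and> h 0 = (\<lambda>_. \<zero>\<^bsub>M\<^esub>) \<and>
      l \<in> carrier ?K \<and> fin_eval Q M h l = \<delta> (single ?G y \<one>\<^bsub>R\<^esub>)" for y
    using hom_sums_fin_eval[OF Q M mult_trace_hom_sums[OF Q M img[OF e[of y]]]] by blast
  then obtain h :: "'i \<Rightarrow> nat \<Rightarrow> 'q \<Rightarrow> 'm" and l :: "'i \<Rightarrow> nat \<Rightarrow> 'q"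
    where h: "\<And>y i. h y i \<in> rmod_hom R Q M" "\<And>y. h y 0 = (\<lambda>_. \<zero>\<^bsub>M\<^esub>)"
      and l: "\<And>y. l y \<in> carrier ?K" "\<And>y. fin_eval Q M (h y) (l y) = \<delta> (single ?G y \<one>\<^bsub>R\<^esub>)"
    by metis
  define \<pi> where "\<pi> = fin_eval ?K M (\<lambda>y. fin_eval Q M (h y))"
  have hy: "fin_eval Q M (h y) \<in> rmod_hom R ?K M" for y
    by (rule fin_eval_hom[OF Q M h(1)])
  have \<pi>: "\<pi> \<in> rmod_hom R ?L M" unfolding \<pi>_def by (rule fin_eval_hom[OF K M hy])
  have \<pi>s: "\<pi> (single ?K y k) = fin_eval Q M (h y) k" if "k \<in> carrier ?K" for y k
    unfolding \<pi>_def by (rule fin_eval_single[OF K M hy that])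
  have b: "single ?K y (l y) \<in> carrier ?L" for y
    by (rule rmod_hom_closed[OF single_hom[OF K] l(1)])
  \<comment> \<open>The basis element y goes to the vector \<open>l y\<close> in block y; \<pi>
    evaluates that block by \<open>h y\<close>, which returns \<delta> of the basis element.\<close>
  define \<beta> where "\<beta> = fin_eval ?G ?L (\<lambda>y a. single ?K y (l y) \<bullet>\<^bsub>?L\<^esub> a)"
  have \<beta>: "\<beta> \<in> rmod_hom R ?F ?L"
    unfolding \<beta>_def by (rule fin_eval_hom[OF G L ract_hom_regular[OF L b]])
  have \<beta>s: "\<beta> (single ?G y a) = single ?K y (l y) \<bullet>\<^bsub>?L\<^esub> a" if "a \<in> carrier ?G" for y a
    unfolding \<beta>_def by (rule fin_eval_single[OF G L ract_hom_regular[OF L b] that])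
  show thesis
  proof (rule that[OF \<beta> \<pi>])
    fix \<phi> :: "'i \<Rightarrow> 'r" assume "\<phi> \<in> carrier ?F"
    then show "\<pi> (\<beta> \<phi>) = \<delta> \<phi>"
    proof (rule fin_rmod_hom_ext[OF G M rmod_hom_comp[OF \<beta> \<pi>] \<delta>, rotated])
      fix y :: 'i and a assume a: "a \<in> carrier ?G"
      have "single ?G y (\<one>\<^bsub>R\<^esub> \<bullet>\<^bsub>?G\<^esub> a) = single ?G y \<one>\<^bsub>R\<^esub> \<bullet>\<^bsub>?F\<^esub> a"
        using a by (intro rmod_hom_ract[OF single_hom[OF G]]) auto
      then have "\<delta> (single ?G y a) = \<delta> (single ?G y \<one>\<^bsub>R\<^esub>) \<bullet>\<^bsub>M\<^esub> a"
        using a rmod_hom_ract[OF \<delta> e, of a y] by simp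
      also have "\<dots> = \<pi> (single ?K y (l y)) \<bullet>\<^bsub>M\<^esub> a" using l \<pi>s by simp
      also have "\<dots> = \<pi> (\<beta> (single ?G y a))"
        using rmod_hom_ract[OF \<pi> b, of a y] a by (simp add: \<beta>s)
      finally show "\<pi> (\<beta> (single ?G y a)) = \<delta> (single ?G y a)" by simp
    qed
  next
    fix y :: 'i and x assume x: "x \<in> carrier Q"
    have "\<pi> (single ?K y (single Q 0 x)) = fin_eval Q M (h y) (single Q 0 x)"
      by (rule \<pi>s[OF rmod_hom_closed[OF single_hom[OF Q] x]])
    also have "\<dots> = \<zero>\<^bsub>M\<^esub>" using fin_eval_single[where h = "h y", OF Q M h(1) x] h(2) by simp
    finally show "\<pi> (single ?K y (single Q 0 x)) = \<zero>\<^bsub>M\<^esub>" .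
  qed
qed

section \<open>Lifting an idempotent modulo the ideal\<close>

text \<open>Let \<mu> reduce F modulo I and let \<sigma> split the free cover of N over R/I. Then
  \<sigma> o cover is an idempotent of F / F I with image isomorphic to N, and \<alpha> is a lift of
  it along \<mu>, available because F is free.\<close>

lemma (in ideal) lift_idempotent:
  fixes N :: "('a set, 'n) rmodule"
  assumes N: "projective_rmod (R Quot I) N"
  obtains \<alpha> q where
    "\<alpha> \<in> rmod_hom R (fin_rmod (regular_rmod R)) (fin_rmod (regular_rmod R) :: ('a, 'n \<Rightarrow> 'a) rmodule)"
    "q \<in> rmod_hom R (fin_rmod (regular_rmod R)) (restrict_rmod R I N)"
    "q ` carrier (fin_rmod (regular_rmod R)) = carrier N"
    "\<And>x. x \<in> carrier (fin_rmod (regular_rmod R)) \<Longrightarrow> q (\<alpha> x) = q x"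
    "\<And>x. \<lbrakk>x \<in> carrier (fin_rmod (regular_rmod R)); q x = \<zero>\<^bsub>N\<^esub>\<rbrakk> \<Longrightarrow>
       \<alpha> x \<in> rmod_mult_ideal (fin_rmod (regular_rmod R)) I"
    "\<And>x. x \<in> carrier (fin_rmod (regular_rmod R)) \<Longrightarrow>
       \<alpha> x \<ominus>\<^bsub>fin_rmod (regular_rmod R)\<^esub> \<alpha> (\<alpha> x) \<in> rmod_mult_ideal (fin_rmod (regular_rmod R)) I"
proof -
  let ?G = "regular_rmod R" and ?G' = "regular_rmod (R Quot I)"
  let ?F = "fin_rmod ?G :: ('a, 'n \<Rightarrow> 'a) rmodule"
  let ?F' = "fin_rmod ?G' :: ('a set, 'n \<Rightarrow> 'a set) rmodule"
  let ?S = "restrict_rmod R I ?F'" and ?T = "restrict_rmod R I N"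
  have NM: "right_module (R Quot I) N" using N by (simp add: projective_rmod_def)
  have G: "right_module R ?G" by (rule regular_rmod_right_module[OF ring_axioms])
  have F: "right_module R ?F" by (rule fin_rmod_right_module[OF G])
  have G': "right_module (R Quot I) ?G'" by (rule regular_rmod_right_module[OF quotient_is_ring])
  have F': "right_module (R Quot I) ?F'" by (rule fin_rmod_right_module[OF G'])
  have S: "right_module R ?S" by (rule restrict_rmod_right_module[OF F'])
  have T: "right_module R ?T" by (rule restrict_rmod_right_module[OF NM])
  interpret F: right_module R ?F by fact
  interpret S: right_module R ?S by fact
  interpret T: right_module R ?T by fact
  define \<mu> :: "('n \<Rightarrow> 'a) \<Rightarrow> 'n \<Rightarrow> 'a set" where "\<mu> \<phi> = (\<lambda>i. I +> \<phi> i)" for \<phi>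
  have \<mu>: "\<mu> \<in> rmod_hom R ?F ?S"
  proof (rule rmod_homI)
    fix \<phi> assume \<phi>: "\<phi> \<in> carrier ?F"
    have "{i. \<mu> \<phi> i \<noteq> \<zero>\<^bsub>?G'\<^esub>} \<subseteq> {i. \<phi> i \<noteq> \<zero>\<^bsub>?G\<^esub>}"
      using zero_closed rcos_eq_zero_iff[of \<zero>]
      by (intro subsetI CollectI notI) (simp add: \<mu>_def)
    then show "\<mu> \<phi> \<in> carrier ?S"
      using \<phi> finite_subset[of "{i. \<mu> \<phi> i \<noteq> \<zero>\<^bsub>?G'\<^esub>}"] by (simp add: fin_rmod_sel \<mu>_def rcos_closed)
  qed (auto simp: fin_rmod_sel \<mu>_def rcos_add rcos_mult)
  \<comment> \<open>The kernel of reduction is F I: the coordinates lie in I, and I is contained in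
    R I because R has a unit.\<close>
  have ker: "\<phi> \<in> rmod_mult_ideal ?F I" if "\<phi> \<in> carrier ?F" "\<mu> \<phi> = \<zero>\<^bsub>?S\<^esub>" for \<phi>
  proof (rule fin_rmod_mult_ideal[OF G a_subset that(1)])
    fix i
    have "\<phi> i \<in> carrier R" using that(1) by (simp add: fin_rmod_sel)
    moreover have "I +> \<phi> i = \<zero>\<^bsub>R Quot I\<^esub>"
      using fun_cong[OF that(2), of i] by (simp add: \<mu>_def fin_rmod_sel)
    ultimately show "\<phi> i \<in> rmod_mult_ideal ?G I"
      using rcos_eq_zero_iff by (intro regular_mult_ideal[OF ring_axioms a_subset]) simp
  qed
  have \<mu>_surj: "\<mu> ` carrier ?F = carrier ?S"
  proof (intro equalityI subsetI)
    fix \<psi> assume \<psi>: "\<psi> \<in> carrier ?S"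
    \<comment> \<open>The zero coset must be represented by zero itself; otherwise the chosen
      preimage could have infinite support.\<close>
    have "\<exists>a. a \<in> carrier R \<and> I +> a = \<psi> i \<and> (\<psi> i = \<zero>\<^bsub>?G'\<^esub> \<longrightarrow> a = \<zero>)" for i
    proof (cases "\<psi> i = \<zero>\<^bsub>?G'\<^esub>")
      case True
      then show ?thesis using rcos_eq_zero_iff[of \<zero>] by (intro exI[of _ \<zero>]) auto
    next
      case False
      have "\<psi> i \<in> carrier (R Quot I)" using \<psi> by (simp add: fin_rmod_sel)
      then show ?thesis using False rcos_surj by (metis imageE)
    qed
    then obtain \<phi> where \<phi>: "\<And>i. \<phi> i \<in> carrier R" "\<And>i. I +> \<phi> i = \<psi> i"
      "\<And>i. \<psi> i = \<zero>\<^bsub>?G'\<^esub> \<Longrightarrow> \<phi> i = \<zero>" by metis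
    have "{i. \<phi> i \<noteq> \<zero>} \<subseteq> {i. \<psi> i \<noteq> \<zero>\<^bsub>?G'\<^esub>}" using \<phi> by auto
    then have "\<phi> \<in> carrier ?F"
      using \<psi> \<phi> by (auto simp: fin_rmod_sel intro: finite_subset)
    moreover have "\<mu> \<phi> = \<psi>" using \<phi> by (auto simp: \<mu>_def)
    ultimately show "\<psi> \<in> \<mu> ` carrier ?F" by blast
  qed (use rmod_hom_closed[OF \<mu>] in auto)
  obtain \<sigma> where \<sigma>: "\<sigma> \<in> rmod_hom (R Quot I) N ?F'"
      "\<And>x. x \<in> carrier N \<Longrightarrow> cover (R Quot I) N (\<sigma> x) = x"
    using projective_section[OF N F' cover_hom[OF NM] cover_surj[OF NM]] by blast
  define q where "q \<phi> = cover (R Quot I) N (\<mu> \<phi>)" for \<phi>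
  have q: "q \<in> rmod_hom R ?F ?T"
    unfolding q_def by (rule rmod_hom_comp[OF \<mu> restrict_rmod_hom[OF cover_hom[OF NM]]])
  have q_surj: "q ` carrier ?F = carrier N"
    unfolding q_def using \<mu>_surj cover_surj[OF NM] by (simp add: image_image[symmetric])
  have "lifts R ?F ?F ?S \<mu>"
    by (intro lifts_fin[OF G F S \<mu>] lifts_regular[OF F S \<mu> \<mu>_surj])
  then obtain \<alpha> where \<alpha>: "\<alpha> \<in> rmod_hom R ?F ?F" "\<And>x. x \<in> carrier ?F \<Longrightarrow> \<mu> (\<alpha> x) = \<sigma> (q x)"
    unfolding lifts_def using rmod_hom_comp[OF q restrict_rmod_hom[OF \<sigma>(1)]] by meson
  have q\<alpha>: "q (\<alpha> x) = q x" if "x \<in> carrier ?F" for x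
    using that \<alpha>(2) \<sigma>(2) rmod_hom_closed[OF q that] by (simp add: q_def[of "\<alpha> x"])
  show thesis
  proof (rule that[OF \<alpha>(1) q q_surj q\<alpha>])
    fix x assume x: "x \<in> carrier ?F"
    have \<alpha>x: "\<alpha> x \<in> carrier ?F" "\<alpha> (\<alpha> x) \<in> carrier ?F" using x rmod_hom_closed[OF \<alpha>(1)] by auto
    show "\<alpha> x \<in> rmod_mult_ideal ?F I" if "q x = \<zero>\<^bsub>N\<^esub>"
      using x that \<alpha>(2) rmod_hom_zero[OF T S restrict_rmod_hom[OF \<sigma>(1)]] \<alpha>x by (intro ker) auto
    \<comment> \<open>\<mu> \<alpha> depends on its argument only through \<open>q\<close>, and
      \<open>q\<close> does not distinguish x from \<alpha> x.\<close>
    have "\<mu> (\<alpha> x \<ominus>\<^bsub>?F\<^esub> \<alpha> (\<alpha> x)) = \<sigma> (q x) \<ominus>\<^bsub>?S\<^esub> \<sigma> (q x)"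
      using rmod_hom_diff[OF F S \<mu> \<alpha>x] \<alpha>(2) \<alpha>x(1) x q\<alpha> by simp
    also have "\<dots> = \<zero>\<^bsub>?S\<^esub>"
      unfolding a_minus_def
      using rmod_hom_closed[OF restrict_rmod_hom[OF \<sigma>(1)] rmod_hom_closed[OF q x]]
      by (rule S.M.r_neg)
    finally show "\<alpha> x \<ominus>\<^bsub>?F\<^esub> \<alpha> (\<alpha> x) \<in> rmod_mult_ideal ?F I"
      using \<alpha>x by (intro ker) auto
  qed
qed

section \<open>Sequences\<close>

lemma fin_rmod_eventually_zero:
  fixes \<phi> :: "nat \<Rightarrow> 'm"
  assumes "\<phi> \<in> carrier (fin_rmod M)"
  shows "\<exists>K. \<forall>k\<ge>K. \<phi> k = \<zero>\<^bsub>M\<^esub>"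
proof -
  have "finite {i. \<phi> i \<noteq> \<zero>\<^bsub>M\<^esub>}" using assms by (simp add: fin_rmod_sel)
  then obtain K where "\<And>k. \<phi> k \<noteq> \<zero>\<^bsub>M\<^esub> \<Longrightarrow> k < K"
    by (auto simp: finite_nat_set_iff_bounded)
  then show ?thesis by (meson not_less)
qed

text \<open>The inverse of c |-> (c_k - c_(k+1)) on finitely supported sequences. The index set is
  cut down to the support to keep the sum finite.\<close>

definition tail :: "('r, 'm) rmodule \<Rightarrow> (nat \<Rightarrow> 'm) \<Rightarrow> nat \<Rightarrow> 'm" where
  "tail M c k = finsum M c {n. k \<le> n \<and> c n \<noteq> \<zero>\<^bsub>M\<^esub>}"

definition shift :: "('r, 'm) rmodule \<Rightarrow> (nat \<Rightarrow> 'm) \<Rightarrow> nat \<Rightarrow> 'm" where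
  "shift M c k = (case k of 0 \<Rightarrow> \<zero>\<^bsub>M\<^esub> | Suc j \<Rightarrow> c j)"

context
  fixes R :: "('r, 'x) ring_scheme" and M :: "('r, 'm) rmodule"
  assumes M: "right_module R M"
begin

interpretation right_module R M by (rule M)

lemma tail_Suc:
  assumes c: "c \<in> carrier (fin_rmod M)"
  shows "tail M c k = c k \<oplus>\<^bsub>M\<^esub> tail M c (Suc k)"
proof -
  let ?S = "{n. Suc k \<le> n \<and> c n \<noteq> \<zero>\<^bsub>M\<^esub>}"
  have c': "c i \<in> carrier M" "finite {i. c i \<noteq> \<zero>\<^bsub>M\<^esub>}" for i
    using c by (auto simp: fin_rmod_sel)
  have fin: "finite ?S" by (rule finite_subset[OF _ c'(2)]) auto
  \<comment> \<open>Inserting k does no harm when c k = 0, so no case distinction arises.\<close>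
  have "tail M c k = finsum M c (insert k ?S)"
    unfolding tail_def
    by (rule M.add.finprod_mono_neutral_cong_left)
       (use c' fin in \<open>auto simp: Suc_le_eq le_less\<close>)
  also have "\<dots> = c k \<oplus>\<^bsub>M\<^esub> tail M c (Suc k)"
    unfolding tail_def by (rule M.finsum_insert) (use c' fin in auto)
  finally show ?thesis .
qed

lemma tail_carrier:
  assumes c: "c \<in> carrier (fin_rmod M)"
  shows "tail M c \<in> carrier (fin_rmod M)"
proof -
  have c': "c i \<in> carrier M" for i using c by (auto simp: fin_rmod_sel)
  obtain K where K: "\<And>k. K \<le> k \<Longrightarrow> c k = \<zero>\<^bsub>M\<^esub>" using fin_rmod_eventually_zero[OF c] by blast
  have "tail M c k = \<zero>\<^bsub>M\<^esub>" if "K \<le> k" for k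
  proof -
    have "{n. k \<le> n \<and> c n \<noteq> \<zero>\<^bsub>M\<^esub>} = {}" using K that by auto
    then show ?thesis unfolding tail_def by (simp only: M.finsum_empty)
  qed
  then have "{k. tail M c k \<noteq> \<zero>\<^bsub>M\<^esub>} \<subseteq> {..<K}" by (auto simp: not_le[symmetric])
  moreover have "tail M c k \<in> carrier M" for k
    unfolding tail_def using c' by (intro M.finsum_closed) auto
  ultimately show ?thesis by (auto simp: fin_rmod_sel intro: finite_subset)
qed

text \<open>The recursion has only one finitely supported solution: both sequences vanish far out,
  and the recursion carries equality downwards.\<close>

lemma tail_eqI:
  assumes c: "c \<in> carrier (fin_rmod M)" and t: "t \<in> carrier (fin_rmod M)"
    and rec: "\<And>k. t k = c k \<oplus>\<^bsub>M\<^esub> t (Suc k)"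
  shows "tail M c = t"
proof
  fix k
  obtain K where K: "\<And>k. K \<le> k \<Longrightarrow> tail M c k = \<zero>\<^bsub>M\<^esub>"
    using fin_rmod_eventually_zero[OF tail_carrier[OF c]] by blast
  obtain K' where K': "\<And>k. K' \<le> k \<Longrightarrow> t k = \<zero>\<^bsub>M\<^esub>" using fin_rmod_eventually_zero[OF t] by blast
  have "k \<le> max k (max K K')" by simp
  then show "tail M c k = t k"
  proof (induction rule: inc_induct)
    case base
    then show ?case using K K' by simp
  next
    case (step n)
    then show ?case using tail_Suc[OF c, of n] rec[of n] by simp
  qed
qed

text \<open>Additivity and linearity come from uniqueness: the right-hand sides satisfy the
  recursion that characterizes the left-hand sides.\<close>

lemma tail_hom: "tail M \<in> rmod_hom R (fin_rmod M) (fin_rmod M)"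
proof (rule rmod_homI)
  interpret F: right_module R "fin_rmod M :: ('r, nat \<Rightarrow> 'm) rmodule"
    by (rule fin_rmod_right_module[OF M])
  fix c :: "nat \<Rightarrow> 'm" assume c: "c \<in> carrier (fin_rmod M)"
  have cc: "c k \<in> carrier M" "tail M c k \<in> carrier M" for k
    using c tail_carrier[OF c] by (auto simp: fin_rmod_sel)
  show "tail M c \<in> carrier (fin_rmod M)" by (rule tail_carrier[OF c])
  {
    fix d :: "nat \<Rightarrow> 'm" assume d: "d \<in> carrier (fin_rmod M)"
    have dc: "d k \<in> carrier M" "tail M d k \<in> carrier M" for k
      using d tail_carrier[OF d] by (auto simp: fin_rmod_sel)
    show "tail M (c \<oplus>\<^bsub>fin_rmod M\<^esub> d) = tail M c \<oplus>\<^bsub>fin_rmod M\<^esub> tail M d"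
    proof (rule tail_eqI)
      fix k
      show "(tail M c \<oplus>\<^bsub>fin_rmod M\<^esub> tail M d) k
          = (c \<oplus>\<^bsub>fin_rmod M\<^esub> d) k \<oplus>\<^bsub>M\<^esub> (tail M c \<oplus>\<^bsub>fin_rmod M\<^esub> tail M d) (Suc k)"
        using tail_Suc[OF c, of k] tail_Suc[OF d, of k] cc dc by (simp add: fin_rmod_sel M.a_ac)
    qed (use c d tail_carrier in auto)
  }
  fix a assume a: "a \<in> carrier R"
  show "tail M (c \<bullet>\<^bsub>fin_rmod M\<^esub> a) = tail M c \<bullet>\<^bsub>fin_rmod M\<^esub> a"
  proof (rule tail_eqI)
    fix k
    show "(tail M c \<bullet>\<^bsub>fin_rmod M\<^esub> a) k = (c \<bullet>\<^bsub>fin_rmod M\<^esub> a) k \<oplus>\<^bsub>M\<^esub> (tail M c \<bullet>\<^bsub>fin_rmod M\<^esub> a) (Suc k)"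
      using tail_Suc[OF c, of k] cc a by (simp add: fin_rmod_sel ract_l_distr)
  qed (use c a tail_carrier in auto)
qed

lemma shift_hom: "shift M \<in> rmod_hom R (fin_rmod M) (fin_rmod M)"
proof (rule rmod_homI)
  fix c :: "nat \<Rightarrow> 'm" assume c: "c \<in> carrier (fin_rmod M)"
  have "{k. shift M c k \<noteq> \<zero>\<^bsub>M\<^esub>} \<subseteq> Suc ` {k. c k \<noteq> \<zero>\<^bsub>M\<^esub>}"
  proof
    fix k assume "k \<in> {k. shift M c k \<noteq> \<zero>\<^bsub>M\<^esub>}"
    then show "k \<in> Suc ` {k. c k \<noteq> \<zero>\<^bsub>M\<^esub>}" by (cases k) (auto simp: shift_def)
  qed
  then show "shift M c \<in> carrier (fin_rmod M)"
    using c by (auto simp: fin_rmod_sel shift_def split: nat.splits intro: finite_subset)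
qed (auto simp: fin_rmod_sel shift_def fun_eq_iff split: nat.splits)

end

section \<open>The telescope\<close>

text \<open>The kernel of the map sending (X, Y) to the sequence X_k - \<alpha> X_k - \<pi> Y_k -
  X_(k+1), written without subtraction.\<close>

definition telescope ::
    "('r, 'f) rmodule \<Rightarrow> ('r, 'l) rmodule \<Rightarrow> ('f \<Rightarrow> 'f) \<Rightarrow> ('l \<Rightarrow> 'f) \<Rightarrow> ('r, nat \<Rightarrow> 'f \<times> 'l) rmodule"
  where "telescope F L \<alpha> \<pi> = fin_rmod (prod_rmod F L)\<lparr>carrier :=
    {w \<in> carrier (fin_rmod (prod_rmod F L)).
      \<forall>k. fst (w k) = \<alpha> (fst (w k)) \<oplus>\<^bsub>F\<^esub> (\<pi> (snd (w k)) \<oplus>\<^bsub>F\<^esub> fst (w (Suc k)))}\<rparr>"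

context
  fixes R :: "('r, 'x) ring_scheme" and F :: "('r, 'f) rmodule" and L :: "('r, 'l) rmodule" and \<alpha> \<beta> \<pi>
  assumes F: "right_module R F" and L: "right_module R L"
    and \<alpha>: "\<alpha> \<in> rmod_hom R F F" and \<pi>: "\<pi> \<in> rmod_hom R L F" and \<beta>: "\<beta> \<in> rmod_hom R F L"
    and idem: "\<forall>x\<in>carrier F. \<alpha> x = \<alpha> (\<alpha> x) \<oplus>\<^bsub>F\<^esub> \<pi> (\<beta> x)"
begin

interpretation F: right_module R F by (rule F)
interpretation L: right_module R L by (rule L)

private abbreviation (input) "H \<equiv> fin_rmod (prod_rmod F L) :: ('r, nat \<Rightarrow> 'f \<times> 'l) rmodule"
private abbreviation (input) "T \<equiv> telescope F L \<alpha> \<pi>"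

lemma H_right_module: "right_module R H"
  by (intro fin_rmod_right_module prod_rmod_right_module F L)

lemma telescope_sel:
  "w \<in> carrier T \<longleftrightarrow> w \<in> carrier H \<and>
    (\<forall>k. fst (w k) = \<alpha> (fst (w k)) \<oplus>\<^bsub>F\<^esub> (\<pi> (snd (w k)) \<oplus>\<^bsub>F\<^esub> fst (w (Suc k))))"
  "\<zero>\<^bsub>T\<^esub> = \<zero>\<^bsub>H\<^esub>" "add T = add H" "ract T = ract H"
  by (simp_all add: telescope_def)

lemma H_carrier: "w \<in> carrier H \<Longrightarrow> fst (w k) \<in> carrier F \<and> snd (w k) \<in> carrier L"
  by (auto simp: fin_rmod_sel)

lemma telescope_right_module: "right_module R T"
  unfolding telescope_def
proof (rule submodule_right_module[OF H_right_module], goal_cases)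
  interpret H: right_module R H by (rule H_right_module)
  {
    \<comment> \<open>The cases 2 to 4 are closure under zero, addition and the action; the first
      goal, inclusion in the carrier, is left to \<open>auto\<close>.\<close>
    case 2
    then show ?case
      using H.M.zero_closed rmod_hom_zero[OF F F \<alpha>] rmod_hom_zero[OF L F \<pi>]
      by (auto simp: fin_rmod_sel(2))
  next
    case (3 v w)
    have v: "\<alpha> (fst (v k)) \<in> carrier F" "\<pi> (snd (v k)) \<in> carrier F" "fst (v k) \<in> carrier F" "snd (v k) \<in> carrier L"
      and w: "\<alpha> (fst (w k)) \<in> carrier F" "\<pi> (snd (w k)) \<in> carrier F" "fst (w k) \<in> carrier F" "snd (w k) \<in> carrier L" for k
      using 3 H_carrier rmod_hom_closed[OF \<alpha>] rmod_hom_closed[OF \<pi>] by blast+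
    have "fst (v k) \<oplus>\<^bsub>F\<^esub> fst (w k)
        = (\<alpha> (fst (v k)) \<oplus>\<^bsub>F\<^esub> (\<pi> (snd (v k)) \<oplus>\<^bsub>F\<^esub> fst (v (Suc k))))
          \<oplus>\<^bsub>F\<^esub> (\<alpha> (fst (w k)) \<oplus>\<^bsub>F\<^esub> (\<pi> (snd (w k)) \<oplus>\<^bsub>F\<^esub> fst (w (Suc k))))" for k
      using 3 by (intro arg_cong2[where f = "add F"]) auto
    also have "\<dots> k = \<alpha> (fst (v k) \<oplus>\<^bsub>F\<^esub> fst (w k)) \<oplus>\<^bsub>F\<^esub> (\<pi> (snd (v k) \<oplus>\<^bsub>L\<^esub> snd (w k))
          \<oplus>\<^bsub>F\<^esub> (fst (v (Suc k)) \<oplus>\<^bsub>F\<^esub> fst (w (Suc k))))" for k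
      using v w by (simp add: rmod_hom_add[OF \<alpha>] rmod_hom_add[OF \<pi>] F.M.a_ac)
    finally show ?case using 3 H.M.a_closed by (auto simp: fin_rmod_sel(3))
  next
    case (4 v a)
    have v: "\<alpha> (fst (v k)) \<in> carrier F" "\<pi> (snd (v k)) \<in> carrier F" "fst (v k) \<in> carrier F" "snd (v k) \<in> carrier L" for k
      using 4 H_carrier rmod_hom_closed[OF \<alpha>] rmod_hom_closed[OF \<pi>] by blast+
    have "fst (v k) \<bullet>\<^bsub>F\<^esub> a
        = (\<alpha> (fst (v k)) \<oplus>\<^bsub>F\<^esub> (\<pi> (snd (v k)) \<oplus>\<^bsub>F\<^esub> fst (v (Suc k)))) \<bullet>\<^bsub>F\<^esub> a" for k
      using 4 by (intro arg_cong2[where f = "ract F"]) auto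
    also have "\<dots> k = \<alpha> (fst (v k) \<bullet>\<^bsub>F\<^esub> a) \<oplus>\<^bsub>F\<^esub> (\<pi> (snd (v k) \<bullet>\<^bsub>L\<^esub> a) \<oplus>\<^bsub>F\<^esub> fst (v (Suc k)) \<bullet>\<^bsub>F\<^esub> a)" for k
      using v 4(2) by (simp add: rmod_hom_ract[OF \<alpha>] rmod_hom_ract[OF \<pi>] F.ract_l_distr)
    finally show ?case using 4 H.ract_closed by (auto simp: fin_rmod_sel(4))
  }
qed auto

lemma telescope_incl_hom: "(\<lambda>w. w) \<in> rmod_hom R T H"
  by (intro rmod_homI) (simp_all add: telescope_sel)

text \<open>Writing \<open>c = \<alpha> X + \<pi> Y\<close> for \<open>w = (X, Y)\<close> and \<open>t\<close> for the sequence of tail sums of \<open>c\<close>,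
  the defining condition of the telescope says \<open>X = t\<close>.  The defect \<open>z = X - t\<close> is
  what the retraction feeds back into the sequence, one step later.\<close>

lemma telescope_retraction:
  obtains \<rho> where "\<rho> \<in> rmod_hom R H T" "\<And>w. w \<in> carrier T \<Longrightarrow> \<rho> w = w"
proof -
  have E: "right_module R (prod_rmod F L)" by (rule prod_rmod_right_module[OF F L])
  let ?FF = "fin_rmod F :: ('r, nat \<Rightarrow> 'f) rmodule"
  have FF: "right_module R ?FF" by (rule fin_rmod_right_module[OF F])
  interpret H: right_module R H by (rule H_right_module)
  define X where "X w = (\<lambda>k. fst (w k))" for w :: "nat \<Rightarrow> 'f \<times> 'l"
  define Y where "Y w = (\<lambda>k. snd (w k))" for w :: "nat \<Rightarrow> 'f \<times> 'l"
  define c where "c w = (\<lambda>k. \<alpha> (fst (w k)) \<oplus>\<^bsub>F\<^esub> \<pi> (snd (w k)))" for w :: "nat \<Rightarrow> 'f \<times> 'l"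
  define t where "t w = tail F (c w)" for w
  define z where "z w = (\<lambda>k. X w k \<ominus>\<^bsub>F\<^esub> t w k)" for w
  \<comment> \<open>The delay makes y_(k+1) = z_k with y_0 = 0, so that a correction in place k + 1
    can cancel the error \<alpha> z_k made in place k.\<close>
  define y where "y w = shift F (z w)" for w
  have X: "X \<in> rmod_hom R H ?FF"
    unfolding X_def by (rule fin_map_hom[OF E F fst_hom])
  have Y: "Y \<in> rmod_hom R H (fin_rmod L)"
    unfolding Y_def by (rule fin_map_hom[OF E L snd_hom])
  have c: "c \<in> rmod_hom R H ?FF"
    unfolding c_def
    by (rule fin_map_hom[OF E F rmod_hom_plus[OF F rmod_hom_comp[OF fst_hom \<alpha>] rmod_hom_comp[OF snd_hom \<pi>]]])
  have t: "t \<in> rmod_hom R H ?FF"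
    unfolding t_def by (rule rmod_hom_comp[OF c tail_hom[OF F]])
  have pw: "(\<lambda>w k. f w k \<oplus>\<^bsub>M\<^esub> g w k) \<in> rmod_hom R H (fin_rmod M)"
    if "right_module R M" "f \<in> rmod_hom R H (fin_rmod M)" "g \<in> rmod_hom R H (fin_rmod M)"
    for f g and M :: "('r, 'n) rmodule"
    using rmod_hom_plus[OF fin_rmod_right_module[OF that(1)] that(2,3)] by (simp add: fin_rmod_sel(3))
  have neg: "(\<lambda>x. \<ominus>\<^bsub>F\<^esub> x) \<in> rmod_hom R F F"
    by (intro rmod_homI) (simp_all add: F.M.minus_add F.M.a_comm F.a_inv_ract)
  have z: "z \<in> rmod_hom R H ?FF"
    unfolding z_def a_minus_def by (rule pw[OF F X rmod_hom_comp[OF t fin_map_hom[OF F F neg]]])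
  have y: "y \<in> rmod_hom R H ?FF"
    unfolding y_def by (rule rmod_hom_comp[OF z shift_hom[OF F]])
  \<comment> \<open>Replacing X by its tail sums t = X - z leaves \<alpha> z_k as the error in
    equation k. Adding \<alpha> y to the first component supplies this term through y_(k+1) = z_k.
    The new terms \<alpha> y_k create the discrepancy \<alpha> y_k - \<alpha> (\<alpha> y_k) = \<pi>
    (\<beta> y_k), which adding \<beta> y to the second component absorbs.\<close>
  define \<rho> where "\<rho> w = (\<lambda>k. (t w k \<oplus>\<^bsub>F\<^esub> \<alpha> (y w k), Y w k \<oplus>\<^bsub>L\<^esub> \<beta> (y w k)))" for w
  have \<rho>H: "\<rho> \<in> rmod_hom R H H"
    unfolding \<rho>_def
    by (intro fin_pair_hom pw[OF F t] pw[OF L Y] rmod_hom_comp[OF y] fin_map_hom F L \<alpha> \<beta>)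
  have carr: "X w k \<in> carrier F" "Y w k \<in> carrier L" "t w k \<in> carrier F" "z w k \<in> carrier F" "y w k \<in> carrier F"
    if "w \<in> carrier H" for w k
    using rmod_hom_closed[OF X that] rmod_hom_closed[OF Y that] rmod_hom_closed[OF t that]
      rmod_hom_closed[OF z that] rmod_hom_closed[OF y that] by (auto simp: fin_rmod_sel)
  note cl = rmod_hom_closed[OF \<alpha>] rmod_hom_closed[OF \<pi>] rmod_hom_closed[OF \<beta>]
  have "\<rho> w \<in> carrier T" if w: "w \<in> carrier H" for w
  proof -
    note C = carr[OF w]
    have "fst (\<rho> w k) = \<alpha> (fst (\<rho> w k)) \<oplus>\<^bsub>F\<^esub> (\<pi> (snd (\<rho> w k)) \<oplus>\<^bsub>F\<^esub> fst (\<rho> w (Suc k)))" for k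
    proof -
      have t1: "t w k = (\<alpha> (X w k) \<oplus>\<^bsub>F\<^esub> \<pi> (Y w k)) \<oplus>\<^bsub>F\<^esub> t w (Suc k)"
        unfolding t_def using tail_Suc[OF F rmod_hom_closed[OF c w], of k]
        by (simp add: c_def X_def Y_def)
      have "X w k = z w k \<oplus>\<^bsub>F\<^esub> t w k"
        using C by (simp add: z_def a_minus_def F.M.a_assoc F.M.l_neg)
      then have aX: "\<alpha> (X w k) = \<alpha> (z w k) \<oplus>\<^bsub>F\<^esub> \<alpha> (t w k)"
        using C by (simp add: rmod_hom_add[OF \<alpha>])
      have y1: "y w (Suc k) = z w k" by (simp add: y_def shift_def)
      have "fst (\<rho> w k) = t w k \<oplus>\<^bsub>F\<^esub> \<alpha> (y w k)" by (simp add: \<rho>_def)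
      also have "\<dots> = ((\<alpha> (z w k) \<oplus>\<^bsub>F\<^esub> \<alpha> (t w k) \<oplus>\<^bsub>F\<^esub> \<pi> (Y w k)) \<oplus>\<^bsub>F\<^esub> t w (Suc k))
            \<oplus>\<^bsub>F\<^esub> (\<alpha> (\<alpha> (y w k)) \<oplus>\<^bsub>F\<^esub> \<pi> (\<beta> (y w k)))"
        using t1 aX bspec[OF idem C(5)[of k]] by simp
      also have "\<dots> = \<alpha> (fst (\<rho> w k)) \<oplus>\<^bsub>F\<^esub> (\<pi> (snd (\<rho> w k)) \<oplus>\<^bsub>F\<^esub> fst (\<rho> w (Suc k)))"
        using C cl by (simp add: \<rho>_def y1 rmod_hom_add[OF \<alpha>] rmod_hom_add[OF \<pi>] F.M.a_ac)
      finally show ?thesis .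
    qed
    then show ?thesis using rmod_hom_closed[OF \<rho>H w] by (simp add: telescope_sel)
  qed
  then have "\<rho> \<in> rmod_hom R H T"
    using rmod_hom_add[OF \<rho>H] rmod_hom_ract[OF \<rho>H] by (intro rmod_homI) (simp_all add: telescope_sel)
  moreover have "\<rho> w = w" if w: "w \<in> carrier T" for w
  proof -
    have wH: "w \<in> carrier H" using w by (simp add: telescope_sel)
    note C = carr[OF wH]
    \<comment> \<open>On the telescope the defining equations are the recursion for the tail sums of
      \<open>c w\<close>, so the defect z vanishes and \<rho> changes nothing.\<close>
    have "t w = X w"
      unfolding t_def
    proof (rule tail_eqI[OF F rmod_hom_closed[OF c wH] rmod_hom_closed[OF X wH]])
      fix k
      have "X w k = \<alpha> (X w k) \<oplus>\<^bsub>F\<^esub> (\<pi> (Y w k) \<oplus>\<^bsub>F\<^esub> X w (Suc k))"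
        using w unfolding telescope_sel X_def Y_def by blast
      then show "X w k = c w k \<oplus>\<^bsub>F\<^esub> X w (Suc k)"
        using C cl by (simp add: c_def F.M.a_assoc X_def Y_def)
    qed
    then have "z w k = \<zero>\<^bsub>F\<^esub>" for k
      using C by (simp add: z_def a_minus_def F.M.r_neg)
    then have "y w k = \<zero>\<^bsub>F\<^esub>" for k by (simp add: y_def shift_def split: nat.split)
    then show ?thesis
      using C \<open>t w = X w\<close> rmod_hom_zero[OF F F \<alpha>] rmod_hom_zero[OF F L \<beta>]
      by (simp add: \<rho>_def) (simp add: X_def Y_def)
  qed
  ultimately show thesis by (rule that)
qed

lemma telescope_lifts:
  assumes "right_module R M" "right_module R N" "g \<in> rmod_hom R M N"
    and "lifts R F M N g" "lifts R L M N g"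
  shows "lifts R T M N g"
proof -
  obtain \<rho> where \<rho>: "\<rho> \<in> rmod_hom R H T" "\<And>w. w \<in> carrier T \<Longrightarrow> \<rho> w = w"
    using telescope_retraction by blast
  show ?thesis
    by (rule lifts_retract[where i = "\<lambda>w. w", OF telescope_incl_hom \<rho>(1)])
       (use assms \<rho>(2) in \<open>auto intro!: lifts_fin lifts_prod prod_rmod_right_module F L\<close>)
qed

text \<open>With X_1 = 0 the equation in place 0 is precisely \<open>idem\<close>; the later ones
  are trivial. These elements make the map to P' surjective.\<close>

lemma telescope_start:
  assumes x: "x \<in> carrier F"
  shows "single (prod_rmod F L) 0 (\<alpha> x, \<beta> x) \<in> carrier T"
proof -
  have "single (prod_rmod F L) 0 (\<alpha> x, \<beta> x) \<in> carrier H"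
    using x rmod_hom_closed[OF \<alpha>] rmod_hom_closed[OF \<beta>]
    by (intro rmod_hom_closed[OF single_hom[OF prod_rmod_right_module[OF F L]]]) auto
  then show ?thesis
    using x bspec[OF idem x] rmod_hom_zero[OF F F \<alpha>] rmod_hom_zero[OF L F \<pi>]
      rmod_hom_closed[OF \<pi>] rmod_hom_closed[OF \<beta>]
    by (auto simp: telescope_sel single_def)
qed

text \<open>With X = 0 the equations only ask that \<pi> kill the second component. This is how
  copies of Q are placed inside the telescope.\<close>

lemma telescope_inr_hom:
  assumes K: "right_module R K" and i: "i \<in> rmod_hom R K L"
    and \<pi>i: "\<And>x. x \<in> carrier K \<Longrightarrow> \<pi> (i x) = \<zero>\<^bsub>F\<^esub>"
  shows "(\<lambda>x. single (prod_rmod F L) 0 (\<zero>\<^bsub>F\<^esub>, i x)) \<in> rmod_hom R K T"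
proof -
  let ?j = "\<lambda>x. single (prod_rmod F L) (0::nat) (\<zero>\<^bsub>F\<^esub>, i x)"
  have j: "?j \<in> rmod_hom R K H"
    by (rule rmod_hom_comp[OF rmod_hom_comp[OF i inr_hom[OF F]] single_hom[OF prod_rmod_right_module[OF F L]]])
  have "?j x \<in> carrier T" if "x \<in> carrier K" for x
    using rmod_hom_closed[OF j that] \<pi>i[OF that] rmod_hom_zero[OF F F \<alpha>] rmod_hom_zero[OF L F \<pi>]
    by (auto simp: telescope_sel single_def)
  then show ?thesis
    using rmod_hom_add[OF j] rmod_hom_ract[OF j] by (intro rmod_homI) (simp_all add: telescope_sel)
qed

text \<open>The coordinates are first shown to lie in F I and L I, which puts \<open>w\<close> into
  H I for the ambient module H of all finitely supported sequences. Since the telescope is a retract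
  of H, this yields membership in T I.\<close>

lemma telescope_mult_ideal:
  assumes I: "I \<subseteq> carrier R" and LI: "\<And>l. l \<in> carrier L \<Longrightarrow> l \<in> rmod_mult_ideal L I"
    and w: "w \<in> carrier T" and w0: "\<alpha> (fst (w 0)) \<in> rmod_mult_ideal F I"
  shows "w \<in> rmod_mult_ideal T I"
proof -
  note cl = mult_ideal_closed[OF F I]
  have E: "right_module R (prod_rmod F L)" by (rule prod_rmod_right_module[OF F L])
  have wH: "w \<in> carrier H"
    and rec: "fst (w k) = \<alpha> (fst (w k)) \<oplus>\<^bsub>F\<^esub> (\<pi> (snd (w k)) \<oplus>\<^bsub>F\<^esub> fst (w (Suc k)))" for k
    using w by (auto simp: telescope_sel(1))
  note C = H_carrier[OF wH]
  have \<pi>I: "\<pi> (snd (w k)) \<in> rmod_mult_ideal F I" for k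
    using C by (intro rmod_hom_mult_ideal[OF L F \<pi> I] LI) blast
  have cancel: "v \<in> rmod_mult_ideal F I"
    if "u \<in> rmod_mult_ideal F I" "u \<oplus>\<^bsub>F\<^esub> v \<in> rmod_mult_ideal F I" "v \<in> carrier F" for u v
  proof -
    have "v = \<ominus>\<^bsub>F\<^esub> u \<oplus>\<^bsub>F\<^esub> (u \<oplus>\<^bsub>F\<^esub> v)"
      using that cl(2) by (simp add: F.M.a_assoc[symmetric] F.M.l_neg)
    then show ?thesis using that cl(3,4) by metis
  qed
  \<comment> \<open>Applying \<alpha> to equation k gives \<alpha> X_k = \<alpha> (\<alpha> X_k) +
    \<alpha> (\<pi> Y_k) + \<alpha> X_(k+1). All terms but the last are known to lie in F I, hence
    so does the last.\<close>
  have \<alpha>I: "\<alpha> (fst (w k)) \<in> rmod_mult_ideal F I" for k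
  proof (induction k)
    case 0
    show ?case by (rule w0)
  next
    case (Suc k)
    have "\<alpha> (fst (w k)) = \<alpha> (\<alpha> (fst (w k))) \<oplus>\<^bsub>F\<^esub> (\<alpha> (\<pi> (snd (w k))) \<oplus>\<^bsub>F\<^esub> \<alpha> (fst (w (Suc k))))"
      using arg_cong[OF rec[of k], of \<alpha>] C[of k] C[of "Suc k"]
      by (simp add: rmod_hom_add[OF \<alpha>] rmod_hom_closed[OF \<alpha>] rmod_hom_closed[OF \<pi>])
    moreover have "\<alpha> (\<alpha> (fst (w k))) \<in> rmod_mult_ideal F I" "\<alpha> (\<pi> (snd (w k))) \<in> rmod_mult_ideal F I"
      using rmod_hom_mult_ideal[OF F F \<alpha> I] Suc \<pi>I by auto
    ultimately show ?case
      using cancel Suc C[of "Suc k"] cl(2) rmod_hom_closed[OF \<alpha>] by (metis F.M.a_closed)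
  qed
  obtain K where K: "\<And>k. K \<le> k \<Longrightarrow> w k = \<zero>\<^bsub>prod_rmod F L\<^esub>"
    using fin_rmod_eventually_zero[OF wH] by blast
  have "fst (w k) \<in> rmod_mult_ideal F I" for k
  proof -
    \<comment> \<open>Downward induction from a place where the sequence is zero: X_k differs from
      X_(k+1) by elements of F I.\<close>
    have "k \<le> max k K" by simp
    then show ?thesis
    proof (induction rule: inc_induct)
      case base
      then show ?case using K[of "max k K"] cl(1) by simp
    next
      case (step n)
      then show ?case by (subst rec) (intro cl(3) \<alpha>I \<pi>I)
    qed
  qed
  then have "(fst (w k), snd (w k)) \<in> rmod_mult_ideal (prod_rmod F L) I" for k
    using C LI by (intro prod_rmod_mult_ideal[OF F L I]) blast+
  then have "w \<in> rmod_mult_ideal H I"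
    by (intro fin_rmod_mult_ideal[OF E I wH]) simp
  \<comment> \<open>An element of H I lying in T need not be visibly a sum of products from T;
    applying \<rho>, which fixes \<open>w\<close>, turns it into one.\<close>
  moreover obtain \<rho> where \<rho>: "\<rho> \<in> rmod_hom R H T" "\<And>w. w \<in> carrier T \<Longrightarrow> \<rho> w = w"
    using telescope_retraction by blast
  ultimately show ?thesis
    using rmod_hom_mult_ideal[OF H_right_module telescope_right_module \<rho>(1) I] \<rho>(2)[OF w] by metis
qed

end

section \<open>The lifted module\<close>

text \<open>Transport of structure to the prescribed carrier type needs only an injection, so an element
  of \<open>Q\<close> may be replaced by its indicator function; the latter is injective unless \<open>R = 0\<close>.\<close>

definition encode ::
    "('r, 'x) ring_scheme \<Rightarrow> (nat \<Rightarrow> ('p \<Rightarrow> 'r) \<times> ('p \<Rightarrow> nat \<Rightarrow> 'q)) \<Rightarrow> nat \<times> 'p \<times> 'q \<Rightarrow> 'r" where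
  "encode R w = (\<lambda>(j, y, x). case prod_decode j of (n, i) \<Rightarrow>
     (case i of 0 \<Rightarrow> fst (w n) y
      | Suc k \<Rightarrow> if x = snd (w n) y k then \<one>\<^bsub>R\<^esub> else \<zero>\<^bsub>R\<^esub>))"

lemma inj_encode:
  fixes R :: "('r, 'x) ring_scheme"
  assumes "\<one>\<^bsub>R\<^esub> \<noteq> \<zero>\<^bsub>R\<^esub>"
  shows "inj (encode R :: (nat \<Rightarrow> ('p \<Rightarrow> 'r) \<times> ('p \<Rightarrow> nat \<Rightarrow> 'q)) \<Rightarrow> nat \<times> 'p \<times> 'q \<Rightarrow> 'r)"
proof (rule injI)
  fix v w :: "nat \<Rightarrow> ('p \<Rightarrow> 'r) \<times> ('p \<Rightarrow> nat \<Rightarrow> 'q)"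
  assume eq: "encode R v = encode R w"
  have "fst (v n) y = fst (w n) y" for n y
    using fun_cong[OF eq, of "(prod_encode (n, 0), y, undefined)"] by (simp add: encode_def)
  moreover have "snd (v n) y k = snd (w n) y k" for n y k
    \<comment> \<open>Probing at the actual entry of \<open>v\<close> gives 1 on the left, so the
      entry of \<open>w\<close> must be the same because 1 and 0 differ.\<close>
    using fun_cong[OF eq, of "(prod_encode (n, Suc k), y, snd (v n) y k)"] assms
    by (simp add: encode_def split: if_splits)
  ultimately show "v = w" by (intro ext prod_eqI) auto
qed

text \<open>If 1 = 0 in R, the indicators carry no information, but then every module is zero and
  injectivity on its carrier is trivial.\<close>

lemma inj_on_encode:
  assumes "right_module R M"
  shows "inj_on (encode R) (carrier M)"
proof (cases "\<one>\<^bsub>R\<^esub> = \<zero>\<^bsub>R\<^esub>")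
  case True
  interpret right_module R M by fact
  have "x = \<zero>\<^bsub>M\<^esub>" if "x \<in> carrier M" for x
    using ract_one[OF that] ract_zero[OF that] True by simp
  then show ?thesis by (metis inj_onI)
next
  case False
  then show ?thesis using inj_encode inj_on_subset by blast
qed

theorem corollary3p2:
  fixes R :: "('r, 'x) ring_scheme"
    and I :: "'r set"
    and Q :: "('r, 'q) rmodule"
    and P' :: "('r set, 'p) rmodule"
  assumes "ring R"
    and "ideal I R"
    and "projective_rmod R Q"
    and "I = rmod_trace R Q"
    and "projective_rmod (R Quot I) P'"
  shows "\<exists>P :: ('r, nat \<times> 'p \<times> 'q \<Rightarrow> 'r) rmodule.
    projective_rmod R P \<and>
    I \<subseteq> rmod_trace R P \<and>
    rmod_iso (R Quot I) (quot_rmod P I) P' \<and>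
    (\<lambda>t. I +>\<^bsub>R\<^esub> t) ` rmod_trace R P = rmod_trace (R Quot I) P'"
proof -
  let ?G = "regular_rmod R"
  let ?F = "fin_rmod ?G :: ('r, 'p \<Rightarrow> 'r) rmodule"
  let ?L = "fin_rmod (fin_rmod Q) :: ('r, 'p \<Rightarrow> nat \<Rightarrow> 'q) rmodule"
  let ?E = "prod_rmod ?F ?L"
  let ?N = "restrict_rmod R I P'"
  interpret I: ideal I R by fact
  have Q: "right_module R Q" and P': "right_module (R Quot I) P'"
    using assms(3,5) by (simp_all add: projective_rmod_def)
  have G: "right_module R ?G" by (rule regular_rmod_right_module[OF assms(1)])
  have F: "right_module R ?F" by (rule fin_rmod_right_module[OF G])
  have K: "right_module R (fin_rmod Q :: ('r, nat \<Rightarrow> 'q) rmodule)" by (rule fin_rmod_right_module[OF Q])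
  have L: "right_module R ?L" by (rule fin_rmod_right_module[OF K])
  have N: "right_module R ?N" by (rule I.restrict_rmod_right_module[OF P'])
  interpret F: right_module R ?F by fact
  obtain \<alpha> q where \<alpha>: "\<alpha> \<in> rmod_hom R ?F ?F" and q: "q \<in> rmod_hom R ?F ?N"
    and q_surj: "q ` carrier ?F = carrier P'" and q\<alpha>: "\<And>x. x \<in> carrier ?F \<Longrightarrow> q (\<alpha> x) = q x"
    and q_ker: "\<And>x. \<lbrakk>x \<in> carrier ?F; q x = \<zero>\<^bsub>P'\<^esub>\<rbrakk> \<Longrightarrow> \<alpha> x \<in> rmod_mult_ideal ?F I"
    and idem: "\<And>x. x \<in> carrier ?F \<Longrightarrow> \<alpha> x \<ominus>\<^bsub>?F\<^esub> \<alpha> (\<alpha> x) \<in> rmod_mult_ideal ?F I"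
    using I.lift_idempotent[OF assms(5)] by blast
  have \<delta>: "(\<lambda>x. \<alpha> x \<ominus>\<^bsub>?F\<^esub> \<alpha> (\<alpha> x)) \<in> rmod_hom R ?F ?F"
    by (rule rmod_hom_minus[OF F \<alpha> rmod_hom_comp[OF \<alpha> \<alpha>]])
  obtain \<beta> \<pi> where \<beta>: "\<beta> \<in> rmod_hom R ?F ?L" and \<pi>: "\<pi> \<in> rmod_hom R ?L ?F"
    and \<pi>\<beta>: "\<And>x. x \<in> carrier ?F \<Longrightarrow> \<pi> (\<beta> x) = \<alpha> x \<ominus>\<^bsub>?F\<^esub> \<alpha> (\<alpha> x)"
    and \<pi>0: "\<And>y x. x \<in> carrier Q \<Longrightarrow> \<pi> (single (fin_rmod Q) y (single Q 0 x)) = \<zero>\<^bsub>?F\<^esub>"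
    using factor_through_trace[OF Q F \<delta> idem[unfolded assms(4)]] by blast
  have split: "\<forall>x\<in>carrier ?F. \<alpha> x = \<alpha> (\<alpha> x) \<oplus>\<^bsub>?F\<^esub> \<pi> (\<beta> x)"
    using rmod_hom_closed[OF \<alpha>] by (simp add: \<pi>\<beta> a_minus_def F.M.a_lcomm F.M.r_neg)
  \<comment> \<open>L I = L: each entry lies in Q and Q = Q Tr(Q), so two passages to a direct sum
    suffice.\<close>
  have LI: "l \<in> rmod_mult_ideal ?L I" if "l \<in> carrier ?L" for l
  proof (rule fin_rmod_mult_ideal[OF K I.a_subset that])
    fix y
    have "l y \<in> carrier (fin_rmod Q)" using that by (simp add: fin_rmod_sel)
    then show "l y \<in> rmod_mult_ideal (fin_rmod Q) I"
      using projective_mult_trace[OF assms(3)] assms(4)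
      by (intro fin_rmod_mult_ideal[OF Q I.a_subset]) (auto simp: fin_rmod_sel)
  qed
  note tele = F L \<alpha> \<pi> \<beta>

  \<comment> \<open>The telescope and its map onto P'\<close>
  define T where "T = telescope ?F ?L \<alpha> \<pi>"
  have T: "right_module R T" unfolding T_def by (rule telescope_right_module[OF tele, OF split])
  have T_incl: "(\<lambda>w. w) \<in> rmod_hom R T (fin_rmod ?E)"
    unfolding T_def by (rule telescope_incl_hom[OF tele, OF split])
  \<comment> \<open>The fact is polymorphic in the types of \<open>M'\<close> and \<open>N'\<close>.
    It serves both for the types in the definition of projectivity and for the reduction R -> R/I
    needed for the traces.\<close>
  have T_lifts: "lifts R T M' N' g"
    if M': "right_module R M'" and N': "right_module R N'" and g: "g \<in> rmod_hom R M' N'"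
      and surj: "g ` carrier M' = carrier N'"
    for M' :: "('r, 'm) rmodule" and N' :: "('r, 'n) rmodule" and g
  proof -
    have "lifts R Q M' N' g"
      unfolding lifts_def using projective_rmod_lift[OF assms(3) M' N' g surj] by blast
    then show ?thesis
      unfolding T_def
      by (intro telescope_lifts[OF tele, OF split M' N' g] lifts_fin[OF G M' N' g] lifts_fin[OF K M' N' g]
          lifts_fin[OF Q M' N' g] lifts_regular[OF M' N' g surj])
  qed
  define p where "p w = q (fst (w 0))" for w :: "nat \<Rightarrow> ('p \<Rightarrow> 'r) \<times> ('p \<Rightarrow> nat \<Rightarrow> 'q)"
  have p: "p \<in> rmod_hom R T ?N"
    unfolding p_def by (rule rmod_hom_comp[OF rmod_hom_comp[OF rmod_hom_comp[OF T_incl proj_hom] fst_hom] q])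
  have p_surj: "p ` carrier T = carrier P'"
  proof (intro equalityI subsetI)
    fix z assume "z \<in> carrier P'"
    then obtain x where x: "x \<in> carrier ?F" "z = q x" using q_surj by auto
    have "single ?E 0 (\<alpha> x, \<beta> x) \<in> carrier T"
      unfolding T_def by (rule telescope_start[OF tele, OF split x(1)])
    moreover have "p (single ?E 0 (\<alpha> x, \<beta> x)) = z" using x q\<alpha> by (simp add: p_def single_def)
    ultimately show "z \<in> p ` carrier T" by blast
  qed (use rmod_hom_closed[OF p] in auto)
  have p_ker: "w \<in> rmod_mult_ideal T I" if w: "w \<in> carrier T" "p w = \<zero>\<^bsub>P'\<^esub>" for w
  proof -
    have "fst (w 0) \<in> carrier ?F"
      using rmod_hom_closed[OF rmod_hom_comp[OF rmod_hom_comp[OF T_incl proj_hom] fst_hom] w(1)] .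
    then have "\<alpha> (fst (w 0)) \<in> rmod_mult_ideal ?F I" using w(2) by (intro q_ker) (simp_all add: p_def)
    then show ?thesis
      using w(1) unfolding T_def by (intro telescope_mult_ideal[OF tele, OF split I.a_subset] LI)
  qed

  \<comment> \<open>Transport to the prescribed carrier type\<close>
  define P where "P = transport_rmod (encode R) T"
  define d where "d = inv_into (carrier T) (encode R)"
  note inj = inj_on_encode[OF T]
  have P: "right_module R P" and e: "encode R \<in> rmod_hom R T P" and d: "d \<in> rmod_hom R P T"
    unfolding P_def d_def by (rule transport_rmod[OF T inj])+
  have de: "d (encode R w) = w" if "w \<in> carrier T" for w
    unfolding d_def using inj that by (rule inv_into_f_f)
  have P_carrier: "carrier P = encode R ` carrier T" by (simp add: P_def transport_rmod_def Let_def)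
  have ed: "encode R (d u) = u" if "u \<in> carrier P" for u
    using that de by (auto simp: P_carrier)
  have pd: "(\<lambda>u. p (d u)) \<in> rmod_hom R P ?N" by (rule rmod_hom_comp[OF d p])
  have pd_surj: "(\<lambda>u. p (d u)) ` carrier P = carrier P'"
    using p_surj de by (simp add: P_carrier image_image)
  have pd_ker: "u \<in> rmod_mult_ideal P I" if u: "u \<in> carrier P" "p (d u) = \<zero>\<^bsub>P'\<^esub>" for u
    using rmod_hom_mult_ideal[OF T P e I.a_subset p_ker[OF rmod_hom_closed[OF d u(1)] u(2)]] ed[OF u(1)]
    by simp
  have P_lifts: "lifts R P M' N' g" if "lifts R T M' N' g"
    for M' :: "('r, 'm) rmodule" and N' :: "('r, 'n) rmodule" and g
    by (rule lifts_retract[OF d e]) (use ed that in auto)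

  \<comment> \<open>Projectivity, the two traces and the quotient\<close>
  have "projective_rmod R P"
    unfolding projective_rmod_def using P P_lifts[OF T_lifts] unfolding lifts_def by blast
  moreover have "I \<subseteq> rmod_trace R P"
  proof -
    \<comment> \<open>Slot 0 of any block is killed by \<pi>, so an arbitrary index
      \<open>undefined\<close> does; the retraction \<open>r\<close> reads off the same
      coordinate.\<close>
    define i :: "'q \<Rightarrow> 'p \<Rightarrow> nat \<Rightarrow> 'q" where
      "i x = single (fin_rmod Q) undefined (single Q 0 x)" for x
    have i: "i \<in> rmod_hom R Q ?L"
      unfolding i_def by (rule rmod_hom_comp[OF single_hom[OF Q] single_hom[OF K]])
    have j: "(\<lambda>x. single ?E 0 (\<zero>\<^bsub>?F\<^esub>, i x)) \<in> rmod_hom R Q T"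
      unfolding T_def by (rule telescope_inr_hom[OF tele, OF split Q i]) (simp add: i_def \<pi>0)
    have r: "(\<lambda>u. snd (d u 0) undefined 0) \<in> rmod_hom R P Q"
      by (rule rmod_hom_comp[OF rmod_hom_comp[OF rmod_hom_comp[OF rmod_hom_comp[OF
            rmod_hom_comp[OF d T_incl] proj_hom] snd_hom] proj_hom] proj_hom])
    have "rmod_trace R Q \<subseteq> rmod_trace R P"
      by (rule trace_retract[OF assms(1) rmod_hom_comp[OF j e] r])
         (simp add: de rmod_hom_closed[OF j], simp add: single_def i_def)
    then show ?thesis using assms(4) by simp
  qed
  moreover have "rmod_iso (R Quot I) (quot_rmod P I) P'"
    by (rule I.quot_rmod_iso[OF P P' pd pd_surj]) (rule pd_ker)
  moreover have "(\<lambda>t. I +>\<^bsub>R\<^esub> t) ` rmod_trace R P = rmod_trace (R Quot I) P'"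
    using I.rcos_surj
    by (intro I.trace_image[OF P P' pd pd_surj] pd_ker P_lifts T_lifts I.rcos_hom G
        I.restrict_rmod_right_module regular_rmod_right_module I.quotient_is_ring) auto
  ultimately show ?thesis by blast
qed

end
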